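(* Let $X_t$, $t\in\mathbb{R}^d$, be a real measurable strictly stationary random field with $\mathbb{E}X_t=0$ and $\mathbb{E}|X_t|^k<\infty$ for all $k\ge 2$, which has cumulant spectral densities $f_k\in L_1(\mathbb{R}^{d(k-1)})$ of all orders $k\ge 2$. Let $K\subset\mathbb{R}^d$ be a bounded convex set of positive Lebesgue measure $|K|>0$ containing the origin, let $K_T=TK$, and let $S_T=\int_{K_T}X_t\,dt$. Suppose that: (i) there is $p_*$ with $1\le p_*<2$ such that for every $p>p_*$ $$\left(\int_{\mathbb{R}^d}\left|\int_{K}e^{it\lambda}\,dt\right|^p d\lambda\right)^{1/p}<\infty;$$ (ii) the second-order spectral density $f_2$ is bounded and continuous, and $f_2(0)=\frac{1}{(2\pi)^d}\int_{\mathbb{R}^d}\mathbb{E}[X_tX_0]\,dt\neq 0$; (iii) for every $k\ge 3$, $f_k\in L_{p_k}(\mathbb{R}^{d(k-1)})$, where $p_k=\frac{2(k-1)}{k-2}$. Then, as $T\to\infty$, $$\frac{S_T}{T^{d/2}}\overset{D}{\longrightarrow}N(0,\sigma^2),\qquad \sigma^2=(2\pi)^d|K|f_2(0).$$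
   Context: For $k\ge2$, $c_k(t_1,\dots,t_k)$ denotes the joint cumulant of $(X_{t_1},\dots,X_{t_k})$; by stationarity $c_k(t_1,\dots,t_k)=c_k(t_1-t_k,\dots,t_{k-1}-t_k,0)$. Saying that $X$ has cumulant spectral densities $f_k\in L_1(\mathbb{R}^{d(k-1)})$ of all orders means that for every $k\ge 2$ and all $t_1,\dots,t_k\in\mathbb{R}^d$ $$c_k(t_1,\dots,t_k)=\int_{\mathbb{R}^{d(k-1)}}e^{i\sum_{j=1}^{k-1}\lambda_j(t_j-t_k)}f_k(\lambda_1,\dots,\lambda_{k-1})\,d\lambda_1\cdots d\lambda_{k-1},$$ with $\lambda_j\in\mathbb{R}^d$; the $f_k$ are symmetric and may be complex valued. For $t,\lambda\in\mathbb{R}^d$, $t\lambda$ is the Euclidean inner product. $\overset{D}{\to}$ denotes convergence in distribution. *)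

theory Defs
  imports "HOL-Probability.Probability"
begin

definition measurable_field :: "'w measure \<Rightarrow> ('e::euclidean_space \<Rightarrow> 'w \<Rightarrow> real) \<Rightarrow> bool" where
  "measurable_field M X \<longleftrightarrow> (\<lambda>(t, \<omega>). X t \<omega>) \<in> borel_measurable (borel \<Otimes>\<^sub>M M)"

definition strictly_stationary :: "'w measure \<Rightarrow> ('e::euclidean_space \<Rightarrow> 'w \<Rightarrow> real) \<Rightarrow> bool" where
  "strictly_stationary M X \<longleftrightarrow>
     (\<forall>I h. finite I \<longrightarrow>
        distr M (\<Pi>\<^sub>M t\<in>I. borel) (\<lambda>\<omega>. \<lambda>t\<in>I. X (t + h) \<omega>) =
        distr M (\<Pi>\<^sub>M t\<in>I. borel) (\<lambda>\<omega>. \<lambda>t\<in>I. X t \<omega>))"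

(* The joint cumulant of the family (Y j), j in A, by the Leonov-Shiryaev formula: a sum over all
   partitions P of the index set A. Indexing by A keeps repeated variables apart. *)
definition joint_cumulant :: "'w measure \<Rightarrow> 'i set \<Rightarrow> ('i \<Rightarrow> 'w \<Rightarrow> real) \<Rightarrow> real" where
  "joint_cumulant M A Y =
     (\<Sum>P | partition_on A P.
        (-1) ^ (card P - 1) * fact (card P - 1) *
        (\<Prod>B\<in>P. (\<integral>\<omega>. (\<Prod>j\<in>B. Y j \<omega>) \<partial>M)))"

(* Lebesgue measure on the n-fold power of the space 'e. A point is a function on the indices
   0, ..., n - 1 (with value undefined at every other index). *)
abbreviation lborel_pow :: "nat \<Rightarrow> (nat \<Rightarrow> 'e::euclidean_space) measure" where
  "lborel_pow n \<equiv> (\<Pi>\<^sub>M j\<in>{..<n}. lborel)"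

(* Indices are shifted by one: the points t_1, ..., t_k are t 0, ..., t (k - 1), and the
   frequencies \<lambda>_1, ..., \<lambda>_(k-1) are l 0, ..., l (k - 2). The symmetry clause is almost
   everywhere because f k matters only as an element of L_1. *)
definition cumulant_spectral_densities ::
    "'w measure \<Rightarrow> ('e::euclidean_space \<Rightarrow> 'w \<Rightarrow> real) \<Rightarrow> (nat \<Rightarrow> (nat \<Rightarrow> 'e) \<Rightarrow> complex) \<Rightarrow> bool" where
  "cumulant_spectral_densities M X f \<longleftrightarrow>
     (\<forall>k\<ge>2.
        integrable (lborel_pow (k - 1)) (f k) \<and>
        (\<forall>\<pi>. \<pi> permutes {..<k - 1} \<longrightarrow> (AE l in lborel_pow (k - 1). f k (l \<circ> \<pi>) = f k l)) \<and>
        (\<forall>t :: nat \<Rightarrow> 'e.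
           complex_of_real (joint_cumulant M {..<k} (\<lambda>j. X (t j))) =
           (\<integral>l. iexp (\<Sum>j<k - 1. l j \<bullet> (t j - t (k - 1))) * f k l \<partial>lborel_pow (k - 1))))"

definition in_Lp :: "real \<Rightarrow> 'a measure \<Rightarrow> ('a \<Rightarrow> complex) \<Rightarrow> bool" where
  "in_Lp p M f \<longleftrightarrow> f \<in> borel_measurable M \<and> integrable M (\<lambda>x. norm (f x) powr p)"

(* The set integrals over K are taken with respect to the completed measure lebesgue, since a
   bounded convex set is Lebesgue measurable but need not be a Borel set. *)
definition indicator_fourier :: "'e::euclidean_space set \<Rightarrow> 'e \<Rightarrow> complex" where
  "indicator_fourier K l = (CLINT t:K|lebesgue. iexp (t \<bullet> l))"

definition field_integral ::
    "('e::euclidean_space \<Rightarrow> 'w \<Rightarrow> real) \<Rightarrow> 'e set \<Rightarrow> real \<Rightarrow> 'w \<Rightarrow> real" where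
  "field_integral X K T \<omega> = (LINT t:(\<lambda>x. T *\<^sub>R x) ` K|lebesgue. X t \<omega>)"

(* Convergence in distribution along an arbitrary filter; for the filter sequentially this is
   weak_conv_m. *)
definition weak_conv_filter :: "('i \<Rightarrow> real measure) \<Rightarrow> real measure \<Rightarrow> 'i filter \<Rightarrow> bool" where
  "weak_conv_filter \<mu> \<nu> F \<longleftrightarrow>
     (\<forall>x. isCont (cdf \<nu>) x \<longrightarrow> ((\<lambda>i. cdf (\<mu> i) x) \<longlongrightarrow> cdf \<nu> x) F)"

end

theory Submission
  imports Defs
begin

text \<open>The proof is by the method of moments, through cumulants. Write \<open>d\<close> for the dimension,
\<open>G\<close> for the interior of \<open>K\<close>, \<open>N\<close> for Lebesgue measure on \<open>G\<close>
and \<open>Z T = T powr (d / 2) * \<integral>t. X (T t) \<partial>N\<close>. The frontier of a convex set is a null set, so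
\<open>Z T\<close> is the normalised integral of the theorem (\<open>set_integral_scaled_convex\<close>).

By Fubini, the cumulant of order \<open>k\<close> of \<open>Z T\<close> is \<open>T powr (d k / 2)\<close> times the
integral over \<open>N\<close> to the power \<open>k\<close> of the joint cumulants of the field
(\<open>integral_joint_cumulant\<close>). It is enough to show that the cumulant of order 2 tends to
\<open>\<sigma>\<^sup>2\<close> and those of order \<open>k \<ge> 3\<close> tend to 0. Indeed, moments are recovered from
cumulants by inverting the Leonov-Shiryaev formula (\<open>partition_cumulant_inversion\<close>); hence all
moments converge to those of the normal law (\<open>tendsto_gauss_moment\<close>), Taylor expansion of the
characteristic function turns this into pointwise convergence of characteristic functions, and
Levy's continuity theorem applies (\<open>weak_conv_of_moments\<close>).

For \<open>k = n + 1 \<ge> 3\<close>, inserting the spectral density gives the bound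
\<open>\<integral>l. cmod (f k l) * W T l\<close> for the cumulant, where \<open>W T l\<close> is the product of the values of
\<open>w T x = T powr (d / 2) * cmod (char_fun N (T x))\<close> at the \<open>n\<close> frequencies and at their sum. The
arithmetic-geometric idea behind \<open>nn_integral_cyclic_prod_powr_le\<close> bounds the integral of
\<open>W T powr (r n / (n + 1))\<close> by \<open>n + 1\<close> times the \<open>n\<close>-th power of the integral of
\<open>w T powr r\<close>, which is a constant times \<open>T powr (d (r - 2) / 2)\<close>. For \<open>r = 2\<close> the exponent
\<open>2 n / (n + 1)\<close> is conjugate to the exponent assumed for \<open>f k\<close>, and the bound is uniform in
\<open>T\<close>; for \<open>r < 2\<close> the bound tends to 0. Splitting \<open>f k\<close> into a bounded part, paired with
\<open>r < 2\<close>, and a part of small norm, paired with \<open>r = 2\<close>, shows that the integral tends to 0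
(\<open>tendsto_integral_mult_zero\<close>, \<open>tendsto_spectral_integral_zero\<close>).

The variance is treated without Fourier analysis. With \<open>c u\<close> the covariance of \<open>X u\<close> and
\<open>X 0\<close>, substitution turns it into the integral of \<open>c u\<close> times the volume of
\<open>G \<inter> (G + u / T)\<close>, which tends to the volume of \<open>G\<close> times the integral of \<open>c\<close> by dominated
convergence (\<open>tendsto_double_integral_scaled\<close>).\<close>

section \<open>Cumulants and moments\<close>

text \<open>The Leonov-Shiryaev formula for an arbitrary set function \<open>m\<close> in place of the mixed moments.
The joint cumulant is the case where \<open>m B\<close> is the mixed moment of the variables indexed by
\<open>B\<close>; the cumulant of order \<open>card A\<close> of one variable is the case where \<open>m B\<close> is its moment of
order \<open>card B\<close>.\<close>

definition partition_cumulant :: "('i set \<Rightarrow> real) \<Rightarrow> 'i set \<Rightarrow> real" where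
  "partition_cumulant m A = (\<Sum>P | partition_on A P. (-1) ^ (card P - 1) * fact (card P - 1) * (\<Prod>B\<in>P. m B))"

text \<open>Moments in terms of cumulants, in recursive form: the cumulant of the block \<open>B\<close> containing
\<open>a\<close> is multiplied by the moment of all the remaining variables, which are not partitioned further.
After the cumulants are expanded, each partition with at least two blocks receives total weight 0.\<close>

lemma partition_cumulant_inversion:
  fixes m :: "'i set \<Rightarrow> real"
  assumes fin: "finite A" and a: "a \<in> A" and m0: "m {} = 1"
  shows "m A = (\<Sum>B | a \<in> B \<and> B \<subseteq> A. partition_cumulant m B * m (A - B))"
proof -
  define c :: "nat \<Rightarrow> real" where "c p = (-1) ^ (p - 1) * fact (p - 1)" for p
  define Part where "Part B = {P. partition_on B P}" for B :: "'i set"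
  have expand: "partition_cumulant m B = (\<Sum>P\<in>Part B. c (card P) * (\<Prod>B\<in>P. m B))" for B
    by (simp add: partition_cumulant_def c_def Part_def)
  have finPart: "finite (Part B)" if "B \<subseteq> A" for B
    using finitely_many_partition_on[OF finite_subset[OF that fin]] by (simp add: Part_def)
  have finP: "finite P" if "P \<in> Part B" "B \<subseteq> A" for P B
    using that finite_elements[OF finite_subset[OF that(2) fin]] by (auto simp: Part_def)
  define S where "S = {B. a \<in> B \<and> B \<subset> A}"
  have finS: "finite S" unfolding S_def by (rule finite_subset[of _ "Pow A"]) (auto simp: fin)
  have split: "{B. a \<in> B \<and> B \<subseteq> A} = insert A S" using a by (auto simp: S_def)
  have "(\<Sum>B | a \<in> B \<and> B \<subseteq> A. partition_cumulant m B * m (A - B)) = partition_cumulant m A + (\<Sum>B\<in>S. partition_cumulant m B * m (A - B))"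
    unfolding split using finS by (subst sum.insert) (auto simp: S_def m0)
  also have "(\<Sum>B\<in>S. partition_cumulant m B * m (A - B))
     = (\<Sum>B\<in>S. \<Sum>P\<in>Part B. c (card P) * (\<Prod>B\<in>P. m B) * m (A - B))"
    by (simp add: expand sum_distrib_right)
  also have "\<dots> = (\<Sum>(B,P)\<in>Sigma S Part. c (card P) * (\<Prod>B\<in>P. m B) * m (A - B))"
    by (rule sum.Sigma) (use finS finPart in \<open>auto simp: S_def\<close>)
  \<comment> \<open>The pair \<open>(B, P)\<close> corresponds to the partition \<open>Q = insert (A - B) P\<close> of \<open>A\<close> with the
    marked block \<open>C = A - B\<close>, which may be any block not containing \<open>a\<close>.\<close>
  also have "\<dots> = (\<Sum>(Q,C)\<in>Sigma (Part A) (\<lambda>Q. {C\<in>Q. a \<notin> C}). c (card Q - 1) * (\<Prod>B\<in>Q. m B))"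
  proof (rule sum.reindex_bij_witness[where
        i = "\<lambda>(Q,C). (A - C, Q - {C})" and j = "\<lambda>(B,P). (insert (A - B) P, A - B)"])
    fix x assume "x \<in> Sigma S Part"
    moreover obtain B P where x: "x = (B,P)" by (cases x)
    ultimately have B: "a \<in> B" "B \<subset> A" and P: "partition_on B P"
      by (simp_all add: S_def Part_def)
    have nin: "A - B \<notin> P" and UP: "\<Union>P = B"
      using P B by (auto simp: partition_on_def)
    have dj: "disjnt (A - B) (\<Union>P)" using UP by (auto simp: disjnt_def)
    have part: "partition_on A (insert (A - B) P)"
      using P B by (subst partition_on_insert[OF dj]) (auto simp: double_diff)
    show "(case (case x of (B, P) \<Rightarrow> (insert (A - B) P, A - B)) of (Q, C) \<Rightarrow> (A - C, Q - {C})) = x"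
      using B nin by (auto simp: x)
    show "(case x of (B, P) \<Rightarrow> (insert (A - B) P, A - B)) \<in> Sigma (Part A) (\<lambda>Q. {C\<in>Q. a \<notin> C})"
      using part B by (auto simp: x Part_def)
    have fP: "finite P" using finP[of P B] P B by (auto simp: Part_def)
    show "(case case x of (B, P) \<Rightarrow> (insert (A - B) P, A - B) of (Q, C) \<Rightarrow> c (card Q - 1) * (\<Prod>B\<in>Q. m B)) =
          (case x of (B, P) \<Rightarrow> c (card P) * (\<Prod>B\<in>P. m B) * m (A - B))"
      using nin fP by (simp add: x mult_ac)
  next
    fix y assume "y \<in> Sigma (Part A) (\<lambda>Q. {C\<in>Q. a \<notin> C})"
    then obtain Q C where y: "y = (Q,C)" and Q: "partition_on A Q" and C: "C \<in> Q" "a \<notin> C"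
      by (auto simp: Part_def)
    have CA: "C \<subseteq> A" "C \<noteq> {}" using Q C by (auto simp: partition_on_def)
    then have ACC: "A - (A - C) = C" by auto
    show "(case case y of (Q, C) \<Rightarrow> (A - C, Q - {C}) of (B, P) \<Rightarrow> (insert (A - B) P, A - B)) = y"
      using C by (auto simp: y ACC)
    have dj: "disjnt C (\<Union>(Q - {C}))"
      using Q C by (auto simp: partition_on_def disjnt_def disjoint_def pairwise_def)
    have "partition_on (A - C) (Q - {C})"
      using partition_on_insert[OF dj, of A] Q C by (simp add: insert_absorb)
    then show "(case y of (Q, C) \<Rightarrow> (A - C, Q - {C})) \<in> Sigma S Part"
      using C CA a by (auto simp: y S_def Part_def)
  qed
  also have "\<dots> = (\<Sum>Q\<in>Part A. real (card Q - 1) * (c (card Q - 1) * (\<Prod>B\<in>Q. m B)))"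
  proof -
    have cardC: "card {C\<in>Q. a \<notin> C} = card Q - 1" if "Q \<in> Part A" for Q
    proof -
      have Q: "partition_on A Q" using that by (simp add: Part_def)
      then obtain D where D: "D \<in> Q" "a \<in> D" using a by (auto simp: partition_on_def)
      have "{C\<in>Q. a \<notin> C} = Q - {D}"
        using Q D by (auto simp: partition_on_def disjoint_def)
      then show ?thesis using D by simp
    qed
    show ?thesis
      by (subst sum.Sigma[symmetric]) (use finPart finP in \<open>auto simp: cardC\<close>)
  qed
  also have "partition_cumulant m A + \<dots> =
      (\<Sum>Q\<in>Part A. (c (card Q) + real (card Q - 1) * c (card Q - 1)) * (\<Prod>B\<in>Q. m B))"
    by (simp add: expand sum.distrib[symmetric] algebra_simps)
  also have "\<dots> = (\<Sum>Q\<in>Part A. if Q = {A} then m A else 0)"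
  proof (rule sum.cong[OF refl])
    fix Q assume QP: "Q \<in> Part A"
    then have Q: "partition_on A Q" by (simp add: Part_def)
    have "finite Q" using finP[OF QP] by auto
    have "Q \<noteq> {}" using Q a by (auto simp: partition_on_def)
    then have "card Q \<noteq> 0" using \<open>finite Q\<close> by auto
    show "(c (card Q) + real (card Q - 1) * c (card Q - 1)) * (\<Prod>B\<in>Q. m B) = (if Q = {A} then m A else 0)"
    proof (cases "card Q = 1")
      case True
      then obtain D where D: "Q = {D}" by (auto simp: card_1_singleton_iff)
      then have "D = A" using Q by (auto simp: partition_on_def)
      then show ?thesis using D by (simp add: c_def)
    next
      case False
      then obtain p where p: "card Q = Suc (Suc p)"
        using \<open>card Q \<noteq> 0\<close> by (metis One_nat_def not0_implies_Suc)
      then have "Q \<noteq> {A}" by auto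
      moreover have "c (card Q) + real (card Q - 1) * c (card Q - 1) = 0"
        unfolding p c_def by (simp add: algebra_simps)
      ultimately show ?thesis by simp
    qed
  qed
  also have "\<dots> = m A"
  proof -
    have "{A} \<in> Part A" using a by (auto simp: Part_def intro: partition_on_space)
    then show ?thesis using finPart[of A] by (simp add: sum.delta)
  qed
  finally show ?thesis ..
qed

lemma partition_cumulant_card_reindex:
  assumes h: "bij_betw h A A'"
  shows "partition_cumulant (\<lambda>B. g (card B)) A' = partition_cumulant (\<lambda>B. g (card B)) A"
proof -
  have inj: "inj_on h A" and img: "h ` A = A'" using h by (auto simp: bij_betw_def)
  have im: "partition_on (h ` B) ((`) h ` P)" if "partition_on B P" "inj_on h B" for h :: "'x \<Rightarrow> 'y" and B P
  proof -
    have "{} \<notin> (`) h ` P" using that by (auto simp: partition_on_def)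
    then show ?thesis using partition_on_inj_image[OF that] by simp
  qed
  let ?k = "inv_into A h"
  have kinj: "inj_on ?k A'" and kimg: "?k ` A' = A"
    using bij_betw_inv_into[OF h] by (auto simp: bij_betw_def)
  have kh: "?k ` h ` B = B" if "B \<subseteq> A" for B
    using that inj by (rule inv_into_image_cancel[rotated])
  have hk: "h ` ?k ` B = B" if "B \<subseteq> A'" for B
    using that img by (intro image_inv_into_cancel) auto
  have sub: "B \<subseteq> C" if "partition_on C P" "B \<in> P" for B C :: "'x set" and P
    using that by (auto simp: partition_on_def)
  have sub': "B \<subseteq> C" if "partition_on C P" "B \<in> P" for B C :: "'y set" and P
    using that by (auto simp: partition_on_def)
  show ?thesis
    unfolding partition_cumulant_def
  proof (rule sum.reindex_bij_witness[where i = "\<lambda>P. (`) h ` P" and j = "\<lambda>P. (`) ?k ` P"])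
    fix P assume "P \<in> {P. partition_on A' P}"
    then have P: "partition_on A' P" by simp
    have cancel: "h ` ?k ` B = B" if "B \<in> P" for B
      using hk[OF sub'[OF P that]] .
    have "(`) h ` (`) ?k ` P = (\<lambda>B. h ` ?k ` B) ` P" by (rule image_image)
    also have "\<dots> = (\<lambda>B. B) ` P" by (rule image_cong[OF refl cancel])
    finally show "(`) h ` (`) ?k ` P = P" by simp
    show "(`) ?k ` P \<in> {P. partition_on A P}" using im[OF P kinj] kimg by simp
    have kc: "card (?k ` B) = card B" if "B \<in> P" for B
      by (rule card_image[OF inj_on_subset[OF kinj sub'[OF P that]]])
    have injP: "inj_on ((`) ?k) P"
      by (rule inj_on_inverseI[where g = "(`) h"]) (rule cancel)
    show "(- 1) ^ (card ((`) ?k ` P) - 1) * fact (card ((`) ?k ` P) - 1) * (\<Prod>B\<in>(`) ?k ` P. g (card B)) =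
         (- 1) ^ (card P - 1) * fact (card P - 1) * (\<Prod>B\<in>P. g (card B))"
      by (simp add: card_image[OF injP] prod.reindex[OF injP] kc)
  next
    fix P assume "P \<in> {P. partition_on A P}"
    then have P: "partition_on A P" by simp
    have cancel: "?k ` h ` B = B" if "B \<in> P" for B
      using kh[OF sub[OF P that]] .
    have "(`) ?k ` (`) h ` P = (\<lambda>B. ?k ` h ` B) ` P" by (rule image_image)
    also have "\<dots> = (\<lambda>B. B) ` P" by (rule image_cong[OF refl cancel])
    finally show "(`) ?k ` (`) h ` P = P" by simp
    show "(`) h ` P \<in> {P. partition_on A' P}" using im[OF P inj] img by simp
  qed
qed

lemma partition_cumulant_scale:
  assumes A: "finite A"
  shows "partition_cumulant (\<lambda>B. a ^ card B * g B) A = a ^ card A * partition_cumulant g A"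
proof -
  have "(\<Prod>B\<in>P. a ^ card B * g B) = a ^ card A * (\<Prod>B\<in>P. g B)" if P: "partition_on A P" for P
  proof -
    have "finite B" if "B \<in> P" for B
    proof (rule finite_subset[OF _ A])
      show "B \<subseteq> A" using P that by (auto simp: partition_on_def)
    qed
    then have "card A = (\<Sum>B\<in>P. card B)" by (rule product_partition[OF P])
    then show ?thesis by (simp add: prod.distrib power_sum)
  qed
  then show ?thesis
    by (simp add: partition_cumulant_def sum_distrib_left mult_ac)
qed

text \<open>For a centred variable, the cumulants of order 1 and 2 are 0 and the second moment.\<close>

lemma partition_cumulant_low_orders:
  assumes one: "\<mu> 0 = 1" and mean: "\<mu> (Suc 0) = 0"
  shows "partition_cumulant (\<lambda>B. \<mu> (card B)) {..<Suc 0} = 0" and "partition_cumulant (\<lambda>B. \<mu> (card B)) {..<2::nat} = \<mu> 2"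
proof -
  have s1: "{B. 0 \<in> B \<and> B \<subseteq> {..<Suc 0}} = {{0}}" by auto
  have z: "{..<Suc 0} = {0}" by auto
  show "partition_cumulant (\<lambda>B. \<mu> (card B)) {..<Suc 0} = 0"
    using partition_cumulant_inversion[of "{..<Suc 0}" 0 "\<lambda>B. \<mu> (card B)"] one mean unfolding s1 by (simp add: z)
  have s2: "{B. 0 \<in> B \<and> B \<subseteq> {..<2}} = {{0}, {..<2::nat}}"
  proof -
    have t: "{..<2} = {0, 1::nat}" by auto
    show ?thesis unfolding t by auto
  qed
  have ne: "{0} \<noteq> {..<2::nat}"
  proof
    assume "{0} = {..<2::nat}"
    then have "card {0::nat} = card {..<2::nat}" by (rule arg_cong)
    then show False by simp
  qed
  define c where "c = partition_cumulant (\<lambda>B::nat set. \<mu> (card B))"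
  have "\<mu> (card {..<2::nat}) = (\<Sum>B\<in>{{0}, {..<2::nat}}. c B * \<mu> (card ({..<2} - B)))"
    unfolding c_def s2[symmetric] by (rule partition_cumulant_inversion) (simp_all add: one)
  also have "\<dots> = c {0} * \<mu> (card ({..<2} - {0::nat})) + c {..<2} * \<mu> 0"
    using ne by simp
  also have "\<dots> = c {..<2}" using one mean by simp
  finally show "partition_cumulant (\<lambda>B. \<mu> (card B)) {..<2::nat} = \<mu> 2" by (simp add: c_def)
qed

section \<open>Moments of the normal law and the method of moments\<close>

text \<open>The moments of the centred normal law of variance \<open>s\<close>, by the recursion that the inversion
formula yields when the only nonzero cumulant is the one of order 2.\<close>

fun gauss_moment :: "real \<Rightarrow> nat \<Rightarrow> real" where
  "gauss_moment s 0 = 1"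
| "gauss_moment s (Suc 0) = 0"
| "gauss_moment s (Suc (Suc n)) = real (Suc n) * s * gauss_moment s n"

text \<open>Convergence of the cumulants to those of a normal law implies convergence of the moments. Here
\<open>\<mu> t n\<close> is the moment of order \<open>n\<close> of the \<open>t\<close>-th variable.\<close>

lemma tendsto_gauss_moment:
  fixes \<mu> :: "'t \<Rightarrow> nat \<Rightarrow> real"
  assumes one: "\<And>t. \<mu> t 0 = 1"
    and c1: "((\<lambda>t. partition_cumulant (\<lambda>B. \<mu> t (card B)) {..<Suc 0}) \<longlongrightarrow> 0) F"
    and c2: "((\<lambda>t. partition_cumulant (\<lambda>B. \<mu> t (card B)) {..<2::nat}) \<longlongrightarrow> s) F"
    and c3: "\<And>k::nat. k \<ge> 3 \<Longrightarrow> ((\<lambda>t. partition_cumulant (\<lambda>B. \<mu> t (card B)) {..<k}) \<longlongrightarrow> 0) F"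
  shows "((\<lambda>t. \<mu> t n) \<longlongrightarrow> gauss_moment s n) F"
proof (induction n rule: less_induct)
  case (less n)
  show ?case
  proof (cases n)
    case 0
    then show ?thesis by (simp add: one)
  next
    case (Suc n')
    let ?S = "{B. 0 \<in> B \<and> B \<subseteq> {..<n}}"
    have finS: "finite ?S" by (rule finite_subset[of _ "Pow {..<n}"]) auto
    have fB: "finite B" if "B \<in> ?S" for B using that finite_subset by auto
    have rec: "\<mu> t n = (\<Sum>B\<in>?S. partition_cumulant (\<lambda>B. \<mu> t (card B)) {..<card B} * \<mu> t (n - card B))" for t
    proof -
      have "\<mu> t n = (\<Sum>B\<in>?S. partition_cumulant (\<lambda>B. \<mu> t (card B)) B * \<mu> t (card ({..<n} - B)))"
        using partition_cumulant_inversion[of "{..<n}" 0 "\<lambda>B. \<mu> t (card B)"] Suc one by simp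
      also have "\<dots> = (\<Sum>B\<in>?S. partition_cumulant (\<lambda>B. \<mu> t (card B)) {..<card B} * \<mu> t (n - card B))"
      proof (rule sum.cong[OF refl])
        fix B assume B: "B \<in> ?S"
        obtain h where "bij_betw h {0..<card B} B" using ex_bij_betw_nat_finite[OF fB[OF B]] by blast
        then have "bij_betw h {..<card B} B" by (simp add: atLeast0LessThan)
        from partition_cumulant_card_reindex[OF this, of "\<mu> t"]
        show "partition_cumulant (\<lambda>B. \<mu> t (card B)) B * \<mu> t (card ({..<n} - B)) =
              partition_cumulant (\<lambda>B. \<mu> t (card B)) {..<card B} * \<mu> t (n - card B)"
          using B fB[OF B] by (simp add: card_Diff_subset)
      qed
      finally show ?thesis .
    qed
    \<comment> \<open>The limits of the cumulants. In the limit only the blocks \<open>B = {0, j}\<close> contribute.\<close>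
    define \<kappa> where "\<kappa> k = (if k = (2::nat) then s else 0)" for k
    have \<kappa>: "((\<lambda>t. partition_cumulant (\<lambda>B. \<mu> t (card B)) {..<k}) \<longlongrightarrow> \<kappa> k) F" if "k \<ge> 1" for k
    proof -
      have "k = Suc 0 \<or> k = 2 \<or> k \<ge> 3" using that by linarith
      then consider "k = Suc 0" | "k = 2" | "k \<ge> 3" by blast
      then show ?thesis using c1 c2 c3 by cases (auto simp: \<kappa>_def)
    qed
    have "((\<lambda>t. \<mu> t n) \<longlongrightarrow> (\<Sum>B\<in>?S. \<kappa> (card B) * gauss_moment s (n - card B))) F"
      unfolding rec
    proof (intro tendsto_sum tendsto_mult)
      fix B assume B: "B \<in> ?S"
      have c: "card B \<ge> 1" using fB[OF B] B by (auto simp: Suc_le_eq card_gt_0_iff)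
      then show "((\<lambda>t. partition_cumulant (\<lambda>B. \<mu> t (card B)) {..<card B}) \<longlongrightarrow> \<kappa> (card B)) F" by (rule \<kappa>)
      show "((\<lambda>t. \<mu> t (n - card B)) \<longlongrightarrow> gauss_moment s (n - card B)) F"
        using c Suc by (intro less) auto
    qed
    also have "(\<Sum>B\<in>?S. \<kappa> (card B) * gauss_moment s (n - card B)) = gauss_moment s n"
    proof -
      have pairs: "{B\<in>?S. card B = 2} = (\<lambda>j. {0, j}) ` {1..<n}"
      proof (intro set_eqI iffI)
        fix B assume "B \<in> {B\<in>?S. card B = 2}"
        then have B: "0 \<in> B" "B \<subseteq> {..<n}" "card B = 2" by simp_all
        then have "card (B - {0}) = 1" by simp
        then obtain j where j: "B - {0} = {j}" by (rule card_1_singletonE)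
        then have "B = {0, j}" "j \<in> {1..<n}" using B by auto
        then show "B \<in> (\<lambda>j. {0, j}) ` {1..<n}" by blast
      next
        fix B assume "B \<in> (\<lambda>j. {0, j}) ` {1..<n}"
        then show "B \<in> {B\<in>?S. card B = 2}" by auto
      qed
      have inj: "inj_on (\<lambda>j. {0::nat, j}) {1..<n}" by (auto simp: inj_on_def doubleton_eq_iff)
      have "(\<Sum>B\<in>?S. \<kappa> (card B) * gauss_moment s (n - card B)) =
          (\<Sum>B\<in>?S. if card B = 2 then s * gauss_moment s (n - 2) else 0)"
        by (rule sum.cong) (auto simp: \<kappa>_def)
      also have "\<dots> = (\<Sum>B\<in>{B\<in>?S. card B = 2}. s * gauss_moment s (n - 2))"
        using finS by (subst sum.inter_filter) auto
      also have "\<dots> = real (n - 1) * (s * gauss_moment s (n - 2))"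
        unfolding pairs by (subst sum.reindex[OF inj]) simp
      also have "\<dots> = gauss_moment s n" using Suc by (cases n') auto
      finally show ?thesis .
    qed
    finally show ?thesis .
  qed
qed

lemma gauss_moment_odd: "gauss_moment s (Suc (2 * n)) = 0"
  by (induction n) auto

lemma gauss_moment_even: "gauss_moment s (2 * n) / fact (2 * n) = (s / 2) ^ n / fact n"
proof (induction n)
  case (Suc n)
  have nz: "real (Suc (2 * n)) \<noteq> 0" "real (Suc (Suc (2 * n))) \<noteq> 0" "(fact (2 * n) :: real) \<noteq> 0" by simp_all
  have "gauss_moment s (2 * Suc n) / fact (2 * Suc n)
      = (real (Suc (2 * n)) * s * gauss_moment s (2 * n)) / (real (Suc (Suc (2 * n))) * (real (Suc (2 * n)) * fact (2 * n)))"
    by simp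
  also have "\<dots> = s / real (Suc (Suc (2 * n))) * (gauss_moment s (2 * n) / fact (2 * n))"
    using nz by (simp add: divide_simps del: of_nat_Suc)
  also have "\<dots> = s / (2 * real (Suc n)) * ((s / 2) ^ n / fact n)"
    unfolding Suc.IH by simp
  also have "\<dots> = (s / 2) ^ Suc n / fact (Suc n)"
    by (simp add: field_simps)
  finally show ?case .
qed simp

lemma exp_sums: "(\<lambda>k. x ^ k / fact k) sums exp (x::real)"
  using exp_converges[of x] by (simp add: divide_inverse mult.commute)

text \<open>The Taylor polynomials of even degree of the characteristic function of the normal law.\<close>

lemma gauss_moment_series:
  "(\<lambda>N. \<Sum>k\<le>2 * N. (\<i> * complex_of_real t) ^ k / fact k * complex_of_real (gauss_moment s k))
     \<longlonglongrightarrow> complex_of_real (exp (- (s * t\<^sup>2) / 2))"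
proof -
  have evn: "(\<i> * complex_of_real t) ^ (2 * k) / fact (2 * k) * complex_of_real (gauss_moment s (2 * k))
      = complex_of_real ((- (s * t\<^sup>2) / 2) ^ k / fact k)" for k
  proof -
    have pw: "(\<i> * complex_of_real t) ^ (2 * k) = complex_of_real ((- t\<^sup>2) ^ k)"
      by (simp add: power_mult power_mult_distrib)
    have "(\<i> * complex_of_real t) ^ (2 * k) / fact (2 * k) * complex_of_real (gauss_moment s (2 * k))
      = complex_of_real ((- t\<^sup>2) ^ k * (gauss_moment s (2 * k) / fact (2 * k)))"
      unfolding pw by simp
    also have "\<dots> = complex_of_real ((- (s * t\<^sup>2) / 2) ^ k / fact k)"
      unfolding gauss_moment_even
      by (rule arg_cong[where f = complex_of_real])
         (simp add: power_mult_distrib[symmetric] power_divide[symmetric] mult.commute)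
    finally show ?thesis .
  qed
  have eq: "(\<Sum>k\<le>2 * N. (\<i> * complex_of_real t) ^ k / fact k * complex_of_real (gauss_moment s k))
      = complex_of_real (\<Sum>k<Suc N. (- (s * t\<^sup>2) / 2) ^ k / fact k)" for N
  proof (induction N)
    case (Suc N)
    have "2 * Suc N = Suc (Suc (2 * N))" by simp
    then have "(\<Sum>k\<le>2 * Suc N. (\<i> * complex_of_real t) ^ k / fact k * complex_of_real (gauss_moment s k))
      = (\<Sum>k\<le>2 * N. (\<i> * complex_of_real t) ^ k / fact k * complex_of_real (gauss_moment s k))
        + (\<i> * complex_of_real t) ^ (2 * Suc N) / fact (2 * Suc N) * complex_of_real (gauss_moment s (2 * Suc N))"
      by (simp only: sum.atMost_Suc gauss_moment_odd of_real_0 mult_zero_right add_0_right)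
    then show ?case unfolding Suc.IH evn by simp
  qed simp
  have lim: "(\<lambda>N. \<Sum>k<Suc N. (- (s * t\<^sup>2) / 2) ^ k / fact k) \<longlonglongrightarrow> exp (- (s * t\<^sup>2) / 2)"
    using exp_sums unfolding sums_def by (rule LIMSEQ_Suc)
  show ?thesis unfolding eq by (rule tendsto_of_real[OF lim])
qed

lemma char_normal:
  assumes "\<sigma> > 0"
  shows "char (density lborel (normal_density 0 \<sigma>)) t = complex_of_real (exp (- (\<sigma>\<^sup>2 * t\<^sup>2) / 2))"
proof -
  interpret std: prob_space std_normal_distribution by (rule prob_space_normal_density) simp
  have d0: "distributed std_normal_distribution lborel (\<lambda>x. x) (normal_density 0 1)"
    by (auto simp: distributed_def intro!: distr_id2)
  have "distributed std_normal_distribution lborel (\<lambda>x. 0 + \<sigma> * x) (normal_density (0 + \<sigma> * 0) (\<bar>\<sigma>\<bar> * 1))"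
    by (rule std.normal_density_affine[OF d0]) (use assms in auto)
  then have "density lborel (normal_density 0 \<sigma>) = distr std_normal_distribution lborel (\<lambda>x. \<sigma> * x)"
    using assms by (simp add: distributed_def)
  then have "char (density lborel (normal_density 0 \<sigma>)) t = char std_normal_distribution (t * \<sigma>)"
    unfolding char_def by (simp add: integral_distr mult.assoc)
  also have "\<dots> = complex_of_real (exp (- (\<sigma>\<^sup>2 * t\<^sup>2) / 2))"
    by (simp add: char_std_normal_distribution power_mult_distrib mult.commute)
  finally show ?thesis .
qed

text \<open>Even moments control the Taylor remainder of the characteristic functions uniformly in \<open>n\<close>, and
for the normal law this remainder tends to 0 as the degree grows.\<close>

lemma (in prob_space) char_tendsto_of_moments:
  fixes Z :: "nat \<Rightarrow> 'a \<Rightarrow> real"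
  assumes rv: "\<And>n. random_variable borel (Z n)"
    and int: "\<And>n k. integrable M (\<lambda>\<omega>. Z n \<omega> ^ k)"
    and lim: "\<And>k. (\<lambda>n. expectation (\<lambda>\<omega>. Z n \<omega> ^ k)) \<longlonglongrightarrow> gauss_moment s k"
  shows "(\<lambda>n. char (distr M borel (Z n)) t) \<longlonglongrightarrow> complex_of_real (exp (- (s * t\<^sup>2) / 2))"
proof (rule tendstoI)
  fix e :: real assume "e > 0"
  define L where "L = complex_of_real (exp (- (s * t\<^sup>2) / 2))"
  define p where "p N = (\<Sum>k\<le>2 * N. (\<i> * complex_of_real t) ^ k / fact k * complex_of_real (gauss_moment s k))" for N :: nat
  define b where "b N = 2 * \<bar>t\<bar> ^ (2 * N) / fact (2 * N) * gauss_moment s (2 * N)" for N :: nat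
  have b: "b \<longlonglongrightarrow> 0"
  proof -
    have beq: "b = (\<lambda>N. 2 * ((s * t\<^sup>2 / 2) ^ N / fact N))"
    proof
      fix N
      have "b N = 2 * (\<bar>t\<bar> ^ (2 * N) * (gauss_moment s (2 * N) / fact (2 * N)))"
        by (simp add: b_def)
      then show "b N = 2 * ((s * t\<^sup>2 / 2) ^ N / fact N)"
        unfolding gauss_moment_even
        by (simp only: power_mult power2_abs times_divide_eq_right power_mult_distrib[symmetric]) (simp only: mult.commute)
    qed
    have "(\<lambda>N. (s * t\<^sup>2 / 2) ^ N / fact N) \<longlonglongrightarrow> 0"
      using exp_sums by (intro summable_LIMSEQ_zero) (rule sums_summable)
    then show ?thesis unfolding beq by (rule tendsto_mult_right_zero)
  qed
  have "(\<lambda>N. dist (p N) L + b N) \<longlonglongrightarrow> 0 + 0"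
    using iffD1[OF tendsto_dist_iff gauss_moment_series[of t s]] b unfolding p_def L_def
    by (rule tendsto_add)
  then have "eventually (\<lambda>N. dist (p N) L + b N < e) sequentially"
    using \<open>e > 0\<close> by (intro order_tendstoD) auto
  \<comment> \<open>The degree is chosen from the moments of the normal law alone, before \<open>n\<close> tends to infinity.\<close>
  then obtain N where N: "dist (p N) L + b N < e" by (auto simp: eventually_sequentially)
  define q where "q n = (\<Sum>k\<le>2 * N. (\<i> * complex_of_real t) ^ k / fact k * complex_of_real (expectation (\<lambda>\<omega>. Z n \<omega> ^ k)))" for n
  define r where "r n = 2 * \<bar>t\<bar> ^ (2 * N) / fact (2 * N) * expectation (\<lambda>\<omega>. Z n \<omega> ^ (2 * N))" for n
  have "q \<longlonglongrightarrow> p N" unfolding q_def p_def by (intro tendsto_intros lim)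
  moreover have "r \<longlonglongrightarrow> b N" unfolding r_def b_def by (intro tendsto_intros lim)
  ultimately have "(\<lambda>n. dist (q n) L + r n) \<longlonglongrightarrow> dist (p N) L + b N"
    by (intro tendsto_intros)
  then have ev: "eventually (\<lambda>n. dist (q n) L + r n < e) sequentially"
    using N by (intro order_tendstoD)
  have bound: "dist (char (distr M borel (Z n)) t) (q n) \<le> r n" for n
    using char_approx1'[of "2 * N" "Z n" "distr M borel (Z n)" t] int rv
    unfolding q_def r_def dist_norm
    by (simp add: power_even_abs)
  show "eventually (\<lambda>n. dist (char (distr M borel (Z n)) t) L < e) sequentially"
    unfolding L_def[symmetric]
    using ev
  proof eventually_elim
    case (elim n)
    then show ?case
      using bound[of n] dist_triangle[of "char (distr M borel (Z n)) t" L "q n"] by linarith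
  qed
qed

lemma (in prob_space) weak_conv_of_moments:
  fixes Z :: "real \<Rightarrow> 'a \<Rightarrow> real"
  assumes \<sigma>: "\<sigma> > 0"
    and rv: "\<And>T. T > 0 \<Longrightarrow> random_variable borel (Z T)"
    and int: "\<And>T k. T > 0 \<Longrightarrow> integrable M (\<lambda>\<omega>. Z T \<omega> ^ k)"
    and lim: "\<And>k. ((\<lambda>T. expectation (\<lambda>\<omega>. Z T \<omega> ^ k)) \<longlongrightarrow> gauss_moment (\<sigma>\<^sup>2) k) at_top"
  shows "weak_conv_filter (\<lambda>T. distr M borel (Z T)) (density lborel (normal_density 0 \<sigma>)) at_top"
  unfolding weak_conv_filter_def
proof (intro allI impI tendsto_at_topI_sequentially)
  fix x and X :: "nat \<Rightarrow> real"
  let ?N = "density lborel (normal_density 0 \<sigma>)"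
  assume cont: "isCont (cdf ?N) x" and X: "filterlim X at_top sequentially"
  \<comment> \<open>Positive indices are needed for all \<open>n\<close>, and \<open>X n\<close> is only eventually positive.\<close>
  define Y where "Y n = max 1 (X n)" for n
  have Y0: "Y n > 0" for n by (simp add: Y_def)
  have Y: "filterlim Y at_top sequentially"
    by (rule filterlim_at_top_mono[OF X]) (simp add: Y_def)
  have "weak_conv_m (\<lambda>n. distr M borel (Z (Y n))) ?N"
  proof (rule levy_continuity)
    show "real_distribution (distr M borel (Z (Y n)))" for n
      using rv[OF Y0] by (rule real_distribution_distr)
    show "real_distribution ?N"
      using prob_space_normal_density[OF \<sigma>, of 0]
      by (auto simp: real_distribution_def real_distribution_axioms_def)
    show "(\<lambda>n. char (distr M borel (Z (Y n))) t) \<longlonglongrightarrow> char ?N t" for t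
      unfolding char_normal[OF \<sigma>]
      by (rule char_tendsto_of_moments[OF rv[OF Y0] int[OF Y0] filterlim_compose[OF lim Y]])
  qed
  then have conv: "(\<lambda>n. cdf (distr M borel (Z (Y n))) x) \<longlonglongrightarrow> cdf ?N x"
    using cont by (simp add: weak_conv_m_def weak_conv_def)
  have "eventually (\<lambda>n. X n \<ge> 1) sequentially"
    using X by (simp add: filterlim_at_top)
  then have "eventually (\<lambda>n. cdf (distr M borel (Z (Y n))) x = cdf (distr M borel (Z (X n))) x) sequentially"
    by eventually_elim (simp add: Y_def max_def)
  then show "(\<lambda>n. cdf (distr M borel (Z (X n))) x) \<longlonglongrightarrow> cdf ?N x"
    using conv by (rule Lim_transform_eventually[rotated])
qed

section \<open>Integrals of a random field against a finite measure\<close>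

lemma joint_cumulant_eq_partition_cumulant: "joint_cumulant M A Y = partition_cumulant (\<lambda>B. \<integral>\<omega>. (\<Prod>j\<in>B. Y j \<omega>) \<partial>M) A"
  by (simp add: joint_cumulant_def partition_cumulant_def)

lemma abs_prod_le_sum_power:
  fixes x :: "'i \<Rightarrow> real"
  assumes "finite A"
  shows "\<bar>\<Prod>j\<in>A. x j\<bar> \<le> 1 + (\<Sum>j\<in>A. \<bar>x j\<bar> ^ card A)"
proof (cases "A = {}")
  case False
  define m where "m = Max ((\<lambda>j. \<bar>x j\<bar>) ` A)"
  have "m \<in> (\<lambda>j. \<bar>x j\<bar>) ` A" unfolding m_def using assms False by (intro Max_in) auto
  then obtain i where i: "i \<in> A" "m = \<bar>x i\<bar>" by auto
  have "\<bar>\<Prod>j\<in>A. x j\<bar> = (\<Prod>j\<in>A. \<bar>x j\<bar>)" by (simp add: abs_prod)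
  also have "\<dots> \<le> (\<Prod>j\<in>A. m)"
    unfolding m_def using assms by (intro prod_mono) auto
  also have "\<dots> = \<bar>x i\<bar> ^ card A" by (simp add: i)
  also have "\<dots> \<le> (\<Sum>j\<in>A. \<bar>x j\<bar> ^ card A)"
    using assms i by (intro member_le_sum) auto
  finally show ?thesis by simp
qed simp

lemma finite_measure_PiM:
  assumes "finite_measure N" "finite A"
  shows "finite_measure (PiM A (\<lambda>_. N))"
proof
  interpret N: finite_measure N by fact
  interpret P: product_sigma_finite "\<lambda>_. N" ..
  have "emeasure (PiM A (\<lambda>_. N)) (space (PiM A (\<lambda>_. N))) = (\<Prod>i\<in>A. emeasure N (space N))"
    unfolding space_PiM using assms by (intro P.emeasure_PiM) auto
  then show "emeasure (PiM A (\<lambda>_. N)) (space (PiM A (\<lambda>_. N))) \<noteq> \<infinity>"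
    using assms by (simp add: ennreal_prod_eq_top power_eq_top_ennreal)
qed

text \<open>Fubini for a product of functions that depend on disjoint blocks of coordinates: \<open>g B\<close> depends
only on the coordinates in \<open>B\<close>. The measure is finite and the factors are bounded, which settles
integrability.\<close>

lemma integral_prod_blocks:
  fixes g :: "'i set \<Rightarrow> ('i \<Rightarrow> 'e) \<Rightarrow> real"
  assumes N: "finite_measure N" and fin: "finite P"
    and blocks: "\<And>B. B \<in> P \<Longrightarrow> finite B" and disj: "disjoint P"
    and meas: "\<And>B. B \<in> P \<Longrightarrow> g B \<in> borel_measurable (PiM B (\<lambda>_. N))"
    and bound: "\<And>B t. B \<in> P \<Longrightarrow> \<bar>g B t\<bar> \<le> D B"
    and restr: "\<And>B t. B \<in> P \<Longrightarrow> g B (restrict t B) = g B t"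
  shows "integrable (PiM (\<Union>P) (\<lambda>_. N)) (\<lambda>t. \<Prod>B\<in>P. g B t)
       \<and> (\<integral>t. (\<Prod>B\<in>P. g B t) \<partial>PiM (\<Union>P) (\<lambda>_. N)) = (\<Prod>B\<in>P. \<integral>t. g B t \<partial>PiM B (\<lambda>_. N))"
proof -
  interpret N: finite_measure N by fact
  interpret pr: product_sigma_finite "\<lambda>_. N" ..
  have meas': "g B \<in> borel_measurable (PiM J (\<lambda>_. N))" if "B \<in> P" "B \<subseteq> J" for B J
  proof -
    have "(\<lambda>t. g B (restrict t B)) \<in> borel_measurable (PiM J (\<lambda>_. N))"
      by (rule measurable_compose[OF measurable_restrict_subset[OF that(2)] meas[OF that(1)]])
    then show ?thesis by (simp add: restr that)
  qed
  have int: "integrable (PiM (\<Union>P') (\<lambda>_. N)) (\<lambda>t. \<Prod>B\<in>P'. g B t)" if "P' \<subseteq> P" for P'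
  proof -
    have finP': "finite P'" using that fin finite_subset by auto
    interpret F: finite_measure "PiM (\<Union>P') (\<lambda>_. N)"
      using that blocks finP' by (intro finite_measure_PiM N) auto
    show ?thesis
    proof (rule F.integrable_const_bound[where B = "\<Prod>B\<in>P'. D B"])
      show "AE t in PiM (\<Union>P') (\<lambda>_. N). norm (\<Prod>B\<in>P'. g B t) \<le> (\<Prod>B\<in>P'. D B)"
        using that by (intro AE_I2) (auto simp: abs_prod intro!: prod_mono bound)
      show "(\<lambda>t. \<Prod>B\<in>P'. g B t) \<in> borel_measurable (PiM (\<Union>P') (\<lambda>_. N))"
        using that by (intro borel_measurable_prod meas') auto
    qed
  qed
  have "(\<integral>t. (\<Prod>B\<in>P'. g B t) \<partial>PiM (\<Union>P') (\<lambda>_. N)) = (\<Prod>B\<in>P'. \<integral>t. g B t \<partial>PiM B (\<lambda>_. N))"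
    if "finite P'" "P' \<subseteq> P" for P'
    using that
  proof (induction P' rule: finite_induct)
    case empty
    interpret e: prob_space "PiM {} (\<lambda>_. N) :: ('i \<Rightarrow> 'e) measure"
      by standard (simp add: PiM_empty emeasure_count_space)
    show ?case by (simp add: e.prob_space)
  next
    case (insert B Q)
    let ?U = "\<Union>Q"
    have B: "B \<in> P" and Q: "Q \<subseteq> P" using insert.prems by auto
    have "B \<inter> C = {}" if "C \<in> Q" for C
      by (rule disjointD[OF disj B]) (use that Q insert.hyps in auto)
    then have dj: "B \<inter> ?U = {}" by blast
    have fU: "finite ?U" using blocks Q insert.hyps by auto
    have U: "\<Union>(insert B Q) = B \<union> ?U" by simp
    have merge: "(\<Prod>C\<in>insert B Q. g C (merge B ?U (x, y))) = g B x * (\<Prod>C\<in>Q. g C y)" for x y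
    proof -
      have "g B (merge B ?U (x, y)) = g B x"
        using restr[OF B, of "merge B ?U (x,y)"] restr[OF B, of x] dj by simp
      moreover have "g C (merge B ?U (x, y)) = g C y" if "C \<in> Q" for C
      proof -
        have "restrict (merge B ?U (x, y)) C = restrict y C"
          using dj that by (fastforce simp: merge_def fun_eq_iff restrict_def)
        then show ?thesis
          using restr[of C "merge B ?U (x,y)"] restr[of C y] that Q by auto
      qed
      ultimately show ?thesis using insert.hyps by simp
    qed
    have "(\<integral>t. (\<Prod>C\<in>insert B Q. g C t) \<partial>PiM (\<Union>(insert B Q)) (\<lambda>_. N))
        = (\<integral>x. \<integral>y. (\<Prod>C\<in>insert B Q. g C (merge B ?U (x, y))) \<partial>PiM ?U (\<lambda>_. N) \<partial>PiM B (\<lambda>_. N))"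
      unfolding U using int[OF insert.prems] U blocks[OF B] fU dj
      by (intro pr.product_integral_fold) auto
    also have "\<dots> = (\<integral>x. g B x \<partial>PiM B (\<lambda>_. N)) * (\<integral>y. (\<Prod>C\<in>Q. g C y) \<partial>PiM ?U (\<lambda>_. N))"
      unfolding merge by simp
    finally show ?case using insert Q by simp
  qed
  then show ?thesis using int[OF order_refl] fin by blast
qed

text \<open>A jointly measurable field \<open>Y\<close>, indexed by the points of a finite measure space \<open>N\<close>, whose
absolute moment of each order \<open>k\<close> is bounded by a constant \<open>C k\<close> independent of the
point.\<close>

locale integrated_field = prob_space M + N: finite_measure N
  for M :: "'w measure" and N :: "'e measure" +
  fixes Y :: "'e \<Rightarrow> 'w \<Rightarrow> real" and C :: "nat \<Rightarrow> real"
  assumes Y_measurable: "case_prod Y \<in> borel_measurable (N \<Otimes>\<^sub>M M)"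
    and Y_moment: "\<And>t k. integrable M (\<lambda>\<omega>. \<bar>Y t \<omega>\<bar> ^ k)"
    and Y_bound: "\<And>t k. (\<integral>\<omega>. \<bar>Y t \<omega>\<bar> ^ k \<partial>M) \<le> C k"
    and Y_rv: "\<And>t. Y t \<in> borel_measurable M"
begin

text \<open>The integral of a path. For the null set of paths that are not integrable the value is 0.\<close>

definition window_integral :: "'w \<Rightarrow> real" where "window_integral \<omega> = (\<integral>t. Y t \<omega> \<partial>N)"

text \<open>The mixed moment of the field at the points \<open>t j\<close>, \<open>j \<in> A\<close>.\<close>

definition mixed_moment :: "'i set \<Rightarrow> ('i \<Rightarrow> 'e) \<Rightarrow> real" where
  "mixed_moment A t = (\<integral>\<omega>. (\<Prod>j\<in>A. Y (t j) \<omega>) \<partial>M)"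

lemma window_integral_measurable [measurable]: "window_integral \<in> borel_measurable M"
proof -
  have "(\<lambda>(\<omega>, t). Y t \<omega>) \<in> borel_measurable (M \<Otimes>\<^sub>M N)"
    using Y_measurable by (subst measurable_pair_swap_iff) simp
  then show ?thesis unfolding window_integral_def by (rule N.borel_measurable_lebesgue_integral)
qed

lemma prod_measurable:
  "finite A \<Longrightarrow> (\<lambda>(t, \<omega>). \<Prod>j\<in>A. Y (t j) \<omega>) \<in> borel_measurable (PiM A (\<lambda>_. N) \<Otimes>\<^sub>M M)"
proof -
  have "(\<lambda>p. Y (fst p j) (snd p)) \<in> borel_measurable (PiM A (\<lambda>_. N) \<Otimes>\<^sub>M M)" if "j \<in> A" for j
  proof -
    have "(\<lambda>p. (fst p j, snd p)) \<in> (PiM A (\<lambda>_. N) \<Otimes>\<^sub>M M) \<rightarrow>\<^sub>M (N \<Otimes>\<^sub>M M)"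
      using that by measurable
    from measurable_compose[OF this Y_measurable] show ?thesis by simp
  qed
  then show ?thesis by (simp add: case_prod_beta)
qed

lemma prod_integrable:
  assumes "finite A"
  shows "integrable M (\<lambda>\<omega>. \<Prod>j\<in>A. Y (t j) \<omega>)"
    and "(\<integral>\<omega>. \<bar>\<Prod>j\<in>A. Y (t j) \<omega>\<bar> \<partial>M) \<le> 1 + real (card A) * C (card A)"
proof -
  have int: "integrable M (\<lambda>\<omega>. 1 + (\<Sum>j\<in>A. \<bar>Y (t j) \<omega>\<bar> ^ card A))"
    using Y_moment by auto
  have rv: "(\<lambda>\<omega>. \<Prod>j\<in>A. Y (t j) \<omega>) \<in> borel_measurable M"
    using Y_rv by simp
  show i: "integrable M (\<lambda>\<omega>. \<Prod>j\<in>A. Y (t j) \<omega>)"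
    by (rule Bochner_Integration.integrable_bound[OF int rv])
       (use abs_prod_le_sum_power[OF assms] in \<open>auto intro!: AE_I2 order_trans[OF _ abs_ge_self]\<close>)
  have "(\<integral>\<omega>. \<bar>\<Prod>j\<in>A. Y (t j) \<omega>\<bar> \<partial>M) \<le> (\<integral>\<omega>. 1 + (\<Sum>j\<in>A. \<bar>Y (t j) \<omega>\<bar> ^ card A) \<partial>M)"
    using i int abs_prod_le_sum_power[OF assms] by (intro integral_mono) auto
  also have "\<dots> = 1 + (\<Sum>j\<in>A. \<integral>\<omega>. \<bar>Y (t j) \<omega>\<bar> ^ card A \<partial>M)"
    using Y_moment by (simp add: prob_space)
  also have "\<dots> \<le> 1 + (\<Sum>j\<in>A. C (card A))" by (intro add_left_mono sum_mono Y_bound)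
  finally show "(\<integral>\<omega>. \<bar>\<Prod>j\<in>A. Y (t j) \<omega>\<bar> \<partial>M) \<le> 1 + real (card A) * C (card A)" by simp
qed

lemma mixed_moment_bound: "finite A \<Longrightarrow> \<bar>mixed_moment A t\<bar> \<le> 1 + real (card A) * C (card A)"
  unfolding mixed_moment_def using prod_integrable[of A t] integral_abs_bound[of M "\<lambda>\<omega>. \<Prod>j\<in>A. Y (t j) \<omega>"] by linarith

lemma mixed_moment_measurable: "finite A \<Longrightarrow> mixed_moment A \<in> borel_measurable (PiM A (\<lambda>_. N))"
  unfolding mixed_moment_def by (rule borel_measurable_lebesgue_integral[OF prod_measurable])

lemma mixed_moment_restrict: "mixed_moment A (restrict t A) = mixed_moment A t"
  unfolding mixed_moment_def by (auto intro!: Bochner_Integration.integral_cong prod.cong)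

lemma AE_integrable_path: "AE \<omega> in M. integrable N (\<lambda>t. Y t \<omega>)"
proof -
  interpret P: pair_sigma_finite N M ..
  have "integrable (N \<Otimes>\<^sub>M M) (case_prod Y)"
  proof (rule P.Fubini_integrable[OF Y_measurable])
    have m: "(\<lambda>t. \<integral>\<omega>. norm (case_prod Y (t, \<omega>)) \<partial>M) \<in> borel_measurable N"
      using Y_measurable by (intro borel_measurable_lebesgue_integral) simp
    show "integrable N (\<lambda>t. \<integral>\<omega>. norm (case_prod Y (t, \<omega>)) \<partial>M)"
      using m Y_bound[of _ 1] by (intro N.integrable_const_bound[where B = "C 1"]) auto
    show "AE t in N. integrable M (\<lambda>\<omega>. case_prod Y (t, \<omega>))"
      using Y_moment[of _ 1] Y_rv by (intro AE_I2) (auto simp: integrable_abs_iff)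
  qed
  then show ?thesis by (rule P.AE_integrable_snd)
qed

text \<open>A power of the integral is an integral over a product space, so its expectation is an integral of
mixed moments.\<close>

lemma window_integral_power:
  assumes A: "finite A"
  shows "integrable M (\<lambda>\<omega>. window_integral \<omega> ^ card A)"
    and "(\<integral>\<omega>. window_integral \<omega> ^ card A \<partial>M) = (\<integral>t. mixed_moment A t \<partial>PiM A (\<lambda>_. N))"
proof -
  interpret pr: product_sigma_finite "\<lambda>_. N" ..
  interpret F: finite_measure "PiM A (\<lambda>_. N)" by (rule finite_measure_PiM[OF N.finite_measure_axioms A])
  interpret P: pair_sigma_finite "PiM A (\<lambda>_. N)" M ..
  let ?F = "\<lambda>t \<omega>. \<Prod>j\<in>A. Y (t j) \<omega>"
  have int: "integrable (PiM A (\<lambda>_. N) \<Otimes>\<^sub>M M) (case_prod ?F)"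
  proof (rule P.Fubini_integrable)
    show meas: "case_prod ?F \<in> borel_measurable (PiM A (\<lambda>_. N) \<Otimes>\<^sub>M M)"
      using prod_measurable[OF A] .
    have m: "(\<lambda>t. \<integral>\<omega>. norm (case_prod ?F (t, \<omega>)) \<partial>M) \<in> borel_measurable (PiM A (\<lambda>_. N))"
      using meas by (intro borel_measurable_lebesgue_integral) simp
    show "integrable (PiM A (\<lambda>_. N)) (\<lambda>t. \<integral>\<omega>. norm (case_prod ?F (t, \<omega>)) \<partial>M)"
      using m prod_integrable(2)[OF A] by (intro F.integrable_const_bound[where B = "1 + real (card A) * C (card A)"]) auto
    show "AE t in PiM A (\<lambda>_. N). integrable M (\<lambda>\<omega>. case_prod ?F (t, \<omega>))"
      using prod_integrable(1)[OF A] by simp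
  qed
  have eq: "AE \<omega> in M. (\<integral>t. ?F t \<omega> \<partial>PiM A (\<lambda>_. N)) = window_integral \<omega> ^ card A"
    using AE_integrable_path
  proof eventually_elim
    case (elim \<omega>)
    show ?case using pr.product_integral_prod[OF A elim] by (simp add: window_integral_def)
  qed
  have intS: "integrable M (\<lambda>\<omega>. \<integral>t. ?F t \<omega> \<partial>PiM A (\<lambda>_. N))" by (rule P.integrable_snd[OF int])
  show "integrable M (\<lambda>\<omega>. window_integral \<omega> ^ card A)"
    using integrable_cong_AE[OF borel_measurable_integrable[OF intS] _ eq] intS by simp
  have "(\<integral>\<omega>. window_integral \<omega> ^ card A \<partial>M) = (\<integral>\<omega>. \<integral>t. ?F t \<omega> \<partial>PiM A (\<lambda>_. N) \<partial>M)"
    using integral_cong_AE[OF borel_measurable_integrable[OF intS] _ eq] by simp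
  also have "\<dots> = (\<integral>t. mixed_moment A t \<partial>PiM A (\<lambda>_. N))"
    unfolding mixed_moment_def by (rule P.Fubini_integral[OF int])
  finally show "(\<integral>\<omega>. window_integral \<omega> ^ card A \<partial>M) = (\<integral>t. mixed_moment A t \<partial>PiM A (\<lambda>_. N))" .
qed

text \<open>The cumulant of the integral is the integral of the joint cumulants of the field: in the
Leonov-Shiryaev formula the integral of a product over the blocks factorizes.\<close>

lemma integral_joint_cumulant:
  assumes A: "finite A"
  shows "(\<integral>t. joint_cumulant M A (\<lambda>j. Y (t j)) \<partial>PiM A (\<lambda>_. N)) = partition_cumulant (\<lambda>B. \<integral>\<omega>. window_integral \<omega> ^ card B \<partial>M) A"
proof -
  have block: "integrable (PiM A (\<lambda>_. N)) (\<lambda>t. \<Prod>B\<in>P. mixed_moment B t)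
       \<and> (\<integral>t. (\<Prod>B\<in>P. mixed_moment B t) \<partial>PiM A (\<lambda>_. N)) = (\<Prod>B\<in>P. \<integral>t. mixed_moment B t \<partial>PiM B (\<lambda>_. N))"
    if P: "partition_on A P" for P
  proof -
    have U: "\<Union>P = A" using P by (simp add: partition_on_def)
    have f: "finite B" if "B \<in> P" for B using that U A finite_subset by (metis Union_upper)
    have "integrable (PiM (\<Union>P) (\<lambda>_. N)) (\<lambda>t. \<Prod>B\<in>P. mixed_moment B t)
       \<and> (\<integral>t. (\<Prod>B\<in>P. mixed_moment B t) \<partial>PiM (\<Union>P) (\<lambda>_. N)) = (\<Prod>B\<in>P. \<integral>t. mixed_moment B t \<partial>PiM B (\<lambda>_. N))"
      by (rule integral_prod_blocks[where D = "\<lambda>B. 1 + real (card B) * C (card B)"])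
         (use N.finite_measure_axioms finite_elements[OF A P] f P mixed_moment_measurable mixed_moment_bound mixed_moment_restrict
           in \<open>auto simp: partition_on_def\<close>)
    then show ?thesis by (simp add: U)
  qed
  have eq: "joint_cumulant M A (\<lambda>j. Y (t j)) = partition_cumulant (\<lambda>B. mixed_moment B t) A" for t
    by (simp add: joint_cumulant_eq_partition_cumulant mixed_moment_def)
  have "(\<integral>t. joint_cumulant M A (\<lambda>j. Y (t j)) \<partial>PiM A (\<lambda>_. N)) = partition_cumulant (\<lambda>B. \<integral>t. mixed_moment B t \<partial>PiM B (\<lambda>_. N)) A"
    unfolding eq partition_cumulant_def using block by (subst Bochner_Integration.integral_sum) auto
  also have "\<dots> = partition_cumulant (\<lambda>B. \<integral>\<omega>. window_integral \<omega> ^ card B \<partial>M) A"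
    unfolding partition_cumulant_def
  proof (intro sum.cong refl arg_cong2[where f = "(*)"] prod.cong)
    fix P B assume "P \<in> {P. partition_on A P}" "B \<in> P"
    then have "B \<subseteq> A" by (auto simp: partition_on_def)
    then have "finite B" using A by (rule finite_subset)
    then show "(\<integral>t. mixed_moment B t \<partial>PiM B (\<lambda>_. N)) = (\<integral>\<omega>. window_integral \<omega> ^ card B \<partial>M)"
      by (simp add: window_integral_power)
  qed
  finally show "(\<integral>t. joint_cumulant M A (\<lambda>j. Y (t j)) \<partial>PiM A (\<lambda>_. N)) = partition_cumulant (\<lambda>B. \<integral>\<omega>. window_integral \<omega> ^ card B \<partial>M) A" .
qed

end

lemma (in integrated_field) second_moment:
  "(\<integral>\<omega>. window_integral \<omega> ^ 2 \<partial>M) = (\<integral>x. (\<integral>y. (\<integral>\<omega>. Y x \<omega> * Y y \<omega> \<partial>M) \<partial>N) \<partial>N)"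
proof -
  interpret pr: product_sigma_finite "\<lambda>_::nat. N" ..
  let ?A = "insert 1 {0::nat}"
  interpret F: finite_measure "PiM ?A (\<lambda>_. N)" by (rule finite_measure_PiM[OF N.finite_measure_axioms]) simp
  have int: "integrable (PiM ?A (\<lambda>_. N)) (mixed_moment ?A)"
    by (rule F.integrable_const_bound[OF _ mixed_moment_measurable]) (use mixed_moment_bound[of ?A] in auto)
  have "(\<integral>\<omega>. window_integral \<omega> ^ 2 \<partial>M) = (\<integral>t. mixed_moment ?A t \<partial>PiM ?A (\<lambda>_. N))"
    using window_integral_power(2)[of ?A] by (simp add: numeral_2_eq_2)
  also have "\<dots> = (\<integral>t. (\<integral>y. mixed_moment ?A (t(1 := y)) \<partial>N) \<partial>PiM {0} (\<lambda>_. N))"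
    by (rule pr.product_integral_insert[OF _ _ int]) auto
  also have "\<dots> = (\<integral>t. (\<integral>y. (\<integral>\<omega>. Y (t 0) \<omega> * Y y \<omega> \<partial>M) \<partial>N) \<partial>PiM {0::nat} (\<lambda>_. N))"
    by (simp add: mixed_moment_def mult.commute)
  also have "\<dots> = (\<integral>x. (\<integral>y. (\<integral>\<omega>. Y x \<omega> * Y y \<omega> \<partial>M) \<partial>N) \<partial>N)"
  proof (rule pr.product_integral_singleton)
    have "(\<lambda>p. (fst (fst p), snd p)) \<in> ((N \<Otimes>\<^sub>M N) \<Otimes>\<^sub>M M) \<rightarrow>\<^sub>M (N \<Otimes>\<^sub>M M)"
      "(\<lambda>p. (snd (fst p), snd p)) \<in> ((N \<Otimes>\<^sub>M N) \<Otimes>\<^sub>M M) \<rightarrow>\<^sub>M (N \<Otimes>\<^sub>M M)"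
      by measurable
    from this[THEN measurable_compose[OF _ Y_measurable]]
    have "(\<lambda>(p, \<omega>). Y (fst p) \<omega> * Y (snd p) \<omega>) \<in> borel_measurable ((N \<Otimes>\<^sub>M N) \<Otimes>\<^sub>M M)"
      by (simp add: case_prod_beta)
    then have "(\<lambda>p. \<integral>\<omega>. Y (fst p) \<omega> * Y (snd p) \<omega> \<partial>M) \<in> borel_measurable (N \<Otimes>\<^sub>M N)"
      by (rule borel_measurable_lebesgue_integral)
    then show "(\<lambda>x. \<integral>y. (\<integral>\<omega>. Y x \<omega> * Y y \<omega> \<partial>M) \<partial>N) \<in> borel_measurable N"
      by (intro N.borel_measurable_lebesgue_integral) (simp add: case_prod_beta)
  qed
  finally show ?thesis .
qed

section \<open>Spectral representation of the integrated cumulants\<close>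

lemma sigma_finite_lborel_pow: "sigma_finite_measure (lborel_pow n :: (nat \<Rightarrow> 'e::euclidean_space) measure)"
proof -
  interpret product_sigma_finite "\<lambda>_::nat. lborel :: 'e measure" ..
  show ?thesis by (rule sigma_finite) simp
qed

text \<open>The Fourier transform of a measure on a Euclidean space.\<close>

definition char_fun :: "'e::euclidean_space measure \<Rightarrow> 'e \<Rightarrow> complex" where
  "char_fun N l = (\<integral>t. iexp (t \<bullet> l) \<partial>N)"

lemma char_fun_uminus: "char_fun N (- l) = cnj (char_fun N l)"
  unfolding char_fun_def by (subst Bochner_Integration.integral_cnj[symmetric]) (simp add: exp_cnj)

text \<open>The \<open>n\<close> free frequencies \<open>l j\<close> are completed by \<open>- (\<Sum>j<n. l j)\<close>, belonging to the last
point \<open>t n\<close>; then the exponential is a product of functions of the single points.\<close>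

lemma integral_spectral:
  fixes f :: "(nat \<Rightarrow> 'e::euclidean_space) \<Rightarrow> complex" and N :: "'e measure"
  assumes N: "finite_measure N" and sets: "sets N = sets borel"
    and f: "integrable (lborel_pow n) f"
  shows "(\<integral>t. (\<integral>l. iexp (\<Sum>j<n. l j \<bullet> (T *\<^sub>R t j - T *\<^sub>R t n)) * f l \<partial>lborel_pow n) \<partial>PiM {..<Suc n} (\<lambda>_. N))
    = (\<integral>l. f l * ((\<Prod>j<n. char_fun N (T *\<^sub>R l j)) * char_fun N (- (T *\<^sub>R (\<Sum>j<n. l j)))) \<partial>lborel_pow n)"
proof -
  interpret N: finite_measure N by fact
  interpret pr: product_sigma_finite "\<lambda>_. N" ..
  interpret L: sigma_finite_measure "lborel_pow n :: (nat \<Rightarrow> 'e) measure" by (rule sigma_finite_lborel_pow)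
  let ?A = "PiM {..<Suc n} (\<lambda>_. N)"
  interpret F: finite_measure ?A by (rule finite_measure_PiM[OF N]) simp
  interpret P: pair_sigma_finite ?A "lborel_pow n :: (nat \<Rightarrow> 'e) measure" ..
  note [measurable_cong] = sets
  note [measurable] = borel_measurable_integrable[OF f]
  let ?F = "\<lambda>t l. iexp (\<Sum>j<n. l j \<bullet> (T *\<^sub>R t j - T *\<^sub>R t n)) * f l"
  have meas: "case_prod ?F \<in> borel_measurable (?A \<Otimes>\<^sub>M lborel_pow n)"
    by measurable
  have int: "integrable (?A \<Otimes>\<^sub>M lborel_pow n) (case_prod ?F)"
  proof (rule P.Fubini_integrable[OF meas])
    show "integrable ?A (\<lambda>t. \<integral>l. norm (case_prod ?F (t, l)) \<partial>lborel_pow n)"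
      by (simp add: norm_mult)
    show "AE t in ?A. integrable (lborel_pow n) (\<lambda>l. case_prod ?F (t, l))"
      using f by (intro AE_I2) (auto intro!: Bochner_Integration.integrable_bound[OF f] AE_I2 simp: norm_mult)
  qed
  have "(\<integral>t. (\<integral>l. ?F t l \<partial>lborel_pow n) \<partial>?A) = (\<integral>l. (\<integral>t. ?F t l \<partial>?A) \<partial>lborel_pow n)"
    by (rule P.Fubini_integral[OF int, symmetric])
  also have "\<dots> = (\<integral>l. f l * ((\<Prod>j<n. char_fun N (T *\<^sub>R l j)) * char_fun N (- (T *\<^sub>R (\<Sum>j<n. l j)))) \<partial>lborel_pow n)"
  proof (rule Bochner_Integration.integral_cong[OF refl])
    fix l :: "nat \<Rightarrow> 'e"
    define m where "m j = (if j < n then T *\<^sub>R l j else - (T *\<^sub>R (\<Sum>j<n. l j)))" for j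
    have "(\<Sum>j<n. l j \<bullet> (T *\<^sub>R t j - T *\<^sub>R t n)) = (\<Sum>j<Suc n. t j \<bullet> m j)" for t
    proof -
      have "(\<Sum>j<n. l j \<bullet> (T *\<^sub>R t j - T *\<^sub>R t n)) = (\<Sum>j<n. t j \<bullet> m j) - (\<Sum>j<n. T *\<^sub>R l j) \<bullet> t n"
        unfolding inner_sum_left sum_subtractf[symmetric]
        by (rule sum.cong) (auto simp: m_def inner_diff_right inner_commute)
      also have "\<dots> = (\<Sum>j<Suc n. t j \<bullet> m j)"
        by (simp add: m_def inner_commute scaleR_sum_right)
      finally show ?thesis .
    qed
    then have F: "?F t l = f l * (\<Prod>j<Suc n. iexp (t j \<bullet> m j))" for t
      by (simp only: of_real_sum sum_distrib_left exp_sum[OF finite_lessThan] mult.commute[of _ "f l"])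
    have ci: "integrable N (\<lambda>t. iexp (t \<bullet> m j))" for j
      by (rule N.integrable_const_bound[where B = 1]) (auto simp: norm_exp_i_times)
    have "(\<integral>t. ?F t l \<partial>?A) = f l * (\<integral>t. (\<Prod>j<Suc n. iexp (t j \<bullet> m j)) \<partial>?A)"
      unfolding F by simp
    also have "\<dots> = f l * (\<Prod>j<Suc n. char_fun N (m j))"
      unfolding char_fun_def by (subst pr.product_integral_prod[OF _ ci]) auto
    also have "(\<Prod>j<Suc n. char_fun N (m j)) = (\<Prod>j<n. char_fun N (T *\<^sub>R l j)) * char_fun N (- (T *\<^sub>R (\<Sum>j<n. l j)))"
      by (simp add: m_def)
    finally show "(\<integral>t. ?F t l \<partial>?A) = f l * ((\<Prod>j<n. char_fun N (T *\<^sub>R l j)) * char_fun N (- (T *\<^sub>R (\<Sum>j<n. l j))))" .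
  qed
  finally show ?thesis .
qed

lemma norm_integral_spectral_le:
  fixes f :: "(nat \<Rightarrow> 'e::euclidean_space) \<Rightarrow> complex" and N :: "'e measure"
  assumes N: "finite_measure N" and sets: "sets N = sets borel"
    and f: "integrable (lborel_pow n) f"
  shows "cmod (\<integral>t. (\<integral>l. iexp (\<Sum>j<n. l j \<bullet> (T *\<^sub>R t j - T *\<^sub>R t n)) * f l \<partial>lborel_pow n) \<partial>PiM {..<Suc n} (\<lambda>_. N))
    \<le> (\<integral>l. cmod (f l) * ((\<Prod>j<n. cmod (char_fun N (T *\<^sub>R l j))) * cmod (char_fun N (T *\<^sub>R (\<Sum>j<n. l j)))) \<partial>lborel_pow n)"
  unfolding integral_spectral[OF N sets f] char_fun_uminus
  by (rule order_trans[OF integral_norm_bound]) (simp add: norm_mult prod_norm)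

section \<open>Decay of the spectral integrals\<close>

text \<open>A crude form of the inequality between arithmetic and geometric means for the \<open>n + 1\<close> products
that omit one factor: their geometric mean is at most the largest of them.\<close>

lemma powr_prod_le_sum_prod_delete:
  fixes a :: "nat \<Rightarrow> real"
  assumes a: "\<And>j. a j \<ge> 0" and n: "n \<ge> 1"
  shows "(\<Prod>j\<le>n. a j) powr (real n / real (Suc n)) \<le> (\<Sum>i\<le>n. \<Prod>j\<in>{..n} - {i}. a j)"
proof -
  \<comment> \<open>The largest of the products is the one that omits a smallest factor \<open>a i\<close>.\<close>
  define i where "i = arg_min_on a {..n}"
  have "i \<in> {..n}" unfolding i_def by (rule arg_min_if_finite) auto
  then have i: "i \<le> n" by simp
  have mini: "a i \<le> a j" if "j \<le> n" for j
    unfolding i_def using that by (intro arg_min_least) auto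
  define Q where "Q = (\<Prod>j\<in>{..n} - {i}. a j)"
  have Q0: "Q \<ge> 0" unfolding Q_def using a by (intro prod_nonneg) auto
  have "a i ^ n = (\<Prod>j\<in>{..n} - {i}. a i)" using i by simp
  also have "\<dots> \<le> Q" unfolding Q_def using a mini by (intro prod_mono) auto
  finally have aQ: "a i ^ n \<le> Q" .
  have "a i = (a i ^ n) powr (1 / real n)"
    using a[of i] n by (cases "a i = 0") (auto simp: powr_powr powr_realpow[symmetric])
  also have "\<dots> \<le> Q powr (1 / real n)" using aQ a by (intro powr_mono2) auto
  finally have ai: "a i \<le> Q powr (1 / real n)" .
  have "(\<Prod>j\<le>n. a j) = a i * Q" unfolding Q_def using i by (subst prod.remove[of _ i]) auto
  also have "\<dots> \<le> Q powr (1 / real n) * Q" using ai Q0 by (intro mult_right_mono)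
  also have "\<dots> = Q powr (real (Suc n) / real n)"
    using Q0 n by (cases "Q = 0") (auto simp: powr_add add_divide_distrib)
  finally have "(\<Prod>j\<le>n. a j) powr (real n / real (Suc n)) \<le> (Q powr (real (Suc n) / real n)) powr (real n / real (Suc n))"
    using a by (intro powr_mono2) (auto intro!: prod_nonneg)
  also have "\<dots> = Q" using Q0 n by (cases "Q = 0") (auto simp: powr_powr)
  also have "Q \<le> (\<Sum>i\<le>n. \<Prod>j\<in>{..n} - {i}. a j)"
    unfolding Q_def using a i
    by (intro member_le_sum[where f = "\<lambda>i. \<Prod>j\<in>{..n} - {i}. a j"]) (auto intro!: prod_nonneg)
  finally show ?thesis .
qed

lemma nn_integral_lborel_translate:
  fixes H :: "'e::euclidean_space \<Rightarrow> ennreal"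
  assumes [measurable]: "H \<in> borel_measurable borel"
  shows "(\<integral>\<^sup>+x. H (x + c) \<partial>lborel) = (\<integral>\<^sup>+x. H x \<partial>lborel)"
proof -
  have "(\<integral>\<^sup>+x. H x \<partial>lborel) = (\<integral>\<^sup>+x. H x \<partial>distr lborel borel ((+) c))" by (simp add: lborel_distr_plus)
  also have "\<dots> = (\<integral>\<^sup>+x. H (c + x) \<partial>lborel)" by (subst nn_integral_distr) auto
  finally show ?thesis by (simp add: add.commute)
qed

lemma nn_integral_lborel_scale:
  fixes H :: "'e::euclidean_space \<Rightarrow> ennreal"
  assumes [measurable]: "H \<in> borel_measurable borel" and T: "T > 0"
  shows "(\<integral>\<^sup>+x. H (T *\<^sub>R x) \<partial>lborel) = ennreal (T powr - real DIM('e)) * (\<integral>\<^sup>+x. H x \<partial>lborel)"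
proof -
  have "(\<integral>\<^sup>+x. H x \<partial>lborel) = (\<integral>\<^sup>+x. H x \<partial>density (distr lborel borel (\<lambda>x. 0 + T *\<^sub>R x)) (\<lambda>_. \<bar>T\<bar>^DIM('e)))"
    using T by (subst lborel_affine[of T 0]) auto
  also have "\<dots> = ennreal (T powr real DIM('e)) * (\<integral>\<^sup>+x. H (T *\<^sub>R x) \<partial>lborel)"
    using T by (simp add: nn_integral_density nn_integral_distr nn_integral_cmult powr_realpow ennreal_power)
  finally have "ennreal (T powr - real DIM('e)) * (\<integral>\<^sup>+x. H x \<partial>lborel)
     = ennreal (T powr - real DIM('e) * T powr real DIM('e)) * (\<integral>\<^sup>+x. H (T *\<^sub>R x) \<partial>lborel)"
    using T by (simp add: ennreal_mult mult.assoc)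
  then show ?thesis using T by (simp add: powr_add[symmetric])
qed

text \<open>The \<open>n + 1\<close> linear forms are the \<open>n\<close> coordinates and their sum. Any \<open>n\<close> of them are obtained
from Lebesgue measure by a measure preserving change of variables, so the integral factorizes.\<close>

lemma nn_integral_prod_delete:
  fixes H :: "'e::euclidean_space \<Rightarrow> ennreal"
  assumes H [measurable]: "H \<in> borel_measurable borel" and i: "i \<le> n"
  shows "(\<integral>\<^sup>+l. (\<Prod>j\<in>{..n} - {i}. H (if j < n then l j else \<Sum>j<n. l j)) \<partial>lborel_pow n)
     = (\<integral>\<^sup>+x. H x \<partial>lborel) ^ n"
proof -
  interpret pr: product_sigma_finite "\<lambda>_::nat. lborel :: 'e measure" ..
  show ?thesis
  proof (cases "i = n")
    case True
    then have "{..n} - {i} = {..<n}" by auto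
    then have "(\<integral>\<^sup>+l. (\<Prod>j\<in>{..n} - {i}. H (if j < n then l j else \<Sum>j<n. l j)) \<partial>lborel_pow n)
       = (\<integral>\<^sup>+l. (\<Prod>j<n. H (l j)) \<partial>lborel_pow n)"
      by (intro nn_integral_cong) auto
    also have "\<dots> = (\<integral>\<^sup>+x. H x \<partial>lborel) ^ n"
      by (subst pr.product_nn_integral_prod) auto
    finally show ?thesis .
  next
    case False
    then have i: "i < n" using i by simp
    define I where "I = {..<n} - {i}"
    have I: "finite I" "i \<notin> I" "{..<n} = insert i I" "n \<notin> I" "card I = n - 1" using i by (auto simp: I_def)
    have set: "{..n} - {i} = insert n I" using i by (auto simp: I_def)
    have In: "j < n" if "j \<in> I" for j using that by (auto simp: I_def)
    \<comment> \<open>The coordinate \<open>l i\<close> occurs in the sum only; it is integrated first, by translation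
      invariance.\<close>
    have "(\<integral>\<^sup>+l. (\<Prod>j\<in>{..n} - {i}. H (if j < n then l j else \<Sum>j<n. l j)) \<partial>lborel_pow n)
       = (\<integral>\<^sup>+l. H (\<Sum>j\<in>insert i I. l j) * (\<Prod>j\<in>I. H (l j)) \<partial>PiM (insert i I) (\<lambda>_. lborel))"
      unfolding set I(3)[symmetric] using I(1,4) In by (intro nn_integral_cong) auto
    also have "\<dots> = (\<integral>\<^sup>+l. \<integral>\<^sup>+y. H (\<Sum>j\<in>insert i I. (l(i := y)) j) * (\<Prod>j\<in>I. H ((l(i := y)) j)) \<partial>lborel \<partial>PiM I (\<lambda>_. lborel))"
      by (rule pr.product_nn_integral_insert[OF I(1,2)]) (use I in measurable)
    also have "\<dots> = (\<integral>\<^sup>+l. (\<integral>\<^sup>+y. H y \<partial>lborel) * (\<Prod>j\<in>I. H (l j)) \<partial>PiM I (\<lambda>_. lborel))"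
    proof (rule nn_integral_cong)
      fix l :: "nat \<Rightarrow> 'e"
      have s: "(\<Sum>j\<in>insert i I. (l(i := y)) j) = y + (\<Sum>j\<in>I. l j)" for y
      proof -
        have "(\<Sum>j\<in>I. (l(i := y)) j) = (\<Sum>j\<in>I. l j)" using I(2) by (intro sum.cong) auto
        then show ?thesis using I(1,2) by simp
      qed
      have p: "(\<Prod>j\<in>I. H ((l(i := y)) j)) = (\<Prod>j\<in>I. H (l j))" for y
        using I(2) by (intro prod.cong) auto
      show "(\<integral>\<^sup>+y. H (\<Sum>j\<in>insert i I. (l(i := y)) j) * (\<Prod>j\<in>I. H ((l(i := y)) j)) \<partial>lborel)
         = (\<integral>\<^sup>+y. H y \<partial>lborel) * (\<Prod>j\<in>I. H (l j))"
        unfolding s p by (subst nn_integral_multc) (simp_all add: nn_integral_lborel_translate)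
    qed
    also have "\<dots> = (\<integral>\<^sup>+y. H y \<partial>lborel) * (\<integral>\<^sup>+l. (\<Prod>j\<in>I. H (l j)) \<partial>PiM I (\<lambda>_. lborel))"
      by (rule nn_integral_cmult) measurable
    also have "\<dots> = (\<integral>\<^sup>+y. H y \<partial>lborel) * (\<integral>\<^sup>+y. H y \<partial>lborel) ^ (n - 1)"
      using I by (subst pr.product_nn_integral_prod) auto
    also have "\<dots> = (\<integral>\<^sup>+y. H y \<partial>lborel) ^ n" using i by (simp add: power_eq_if)
    finally show ?thesis .
  qed
qed

text \<open>The product of the values of \<open>w\<close> at \<open>n\<close> frequencies and at their sum.\<close>

definition cyclic_prod :: "nat \<Rightarrow> ('e::euclidean_space \<Rightarrow> real) \<Rightarrow> (nat \<Rightarrow> 'e) \<Rightarrow> real" where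
  "cyclic_prod n w l = (\<Prod>j<n. w (l j)) * w (\<Sum>j<n. l j)"

lemma cyclic_prod_measurable [measurable]:
  "w \<in> borel_measurable borel \<Longrightarrow> cyclic_prod n w \<in> borel_measurable (lborel_pow n)"
proof -
  assume w: "w \<in> borel_measurable borel"
  have "(\<lambda>l. w (l j)) \<in> borel_measurable (lborel_pow n)" if "j < n" for j
    using measurable_component_singleton[of j "{..<n}" "\<lambda>_. lborel :: 'a measure"] that
    by (intro measurable_compose[OF _ w]) simp
  moreover have "(\<lambda>l. w (\<Sum>j<n. l j)) \<in> borel_measurable (lborel_pow n)"
  proof (rule measurable_compose[OF _ w])
    show "(\<lambda>l. \<Sum>j<n. l j) \<in> lborel_pow n \<rightarrow>\<^sub>M (borel :: 'a measure)"
    proof (rule borel_measurable_sum)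
      fix j assume "j \<in> {..<n}"
      then show "(\<lambda>l. l j) \<in> lborel_pow n \<rightarrow>\<^sub>M (borel :: 'a measure)"
        using measurable_component_singleton[of j "{..<n}" "\<lambda>_. lborel :: 'a measure"] by simp
    qed
  qed
  ultimately show ?thesis unfolding cyclic_prod_def by simp
qed

text \<open>A Hoelder-Young inequality for \<open>n + 1\<close> equal functions, up to the factor \<open>n + 1\<close>.\<close>

lemma nn_integral_cyclic_prod_powr_le:
  fixes w :: "'e::euclidean_space \<Rightarrow> real" and r :: real
  assumes w [measurable]: "w \<in> borel_measurable borel" and w0: "\<And>x. w x \<ge> 0" and n: "n \<ge> 1"
  shows "(\<integral>\<^sup>+l. ennreal (cyclic_prod n w l powr (r * real n / real (Suc n))) \<partial>lborel_pow n)
    \<le> of_nat (Suc n) * (\<integral>\<^sup>+x. ennreal (w x powr r) \<partial>lborel) ^ n"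
proof -
  define H where "H x = ennreal (w x powr r)" for x
  have H [measurable]: "H \<in> borel_measurable borel" unfolding H_def by measurable
  define v where "v l j = (if j < n then l j else \<Sum>j<n. l j)" for l :: "nat \<Rightarrow> 'e" and j
  have pt: "ennreal (cyclic_prod n w l powr (r * real n / real (Suc n))) \<le> (\<Sum>i\<le>n. \<Prod>j\<in>{..n} - {i}. H (v l j))" for l
  proof -
    have "cyclic_prod n w l = (\<Prod>j\<le>n. w (v l j))"
      by (simp add: cyclic_prod_def v_def lessThan_Suc_atMost[symmetric])
    then have "cyclic_prod n w l powr (r * real n / real (Suc n)) = (\<Prod>j\<le>n. w (v l j) powr r) powr (real n / real (Suc n))"
      using w0 by (simp add: prod_powr_distrib[symmetric] powr_powr)
    also have "\<dots> \<le> (\<Sum>i\<le>n. \<Prod>j\<in>{..n} - {i}. w (v l j) powr r)"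
      by (rule powr_prod_le_sum_prod_delete[OF _ n]) simp
    finally have "ennreal (cyclic_prod n w l powr (r * real n / real (Suc n))) \<le> ennreal (\<Sum>i\<le>n. \<Prod>j\<in>{..n} - {i}. w (v l j) powr r)"
      by (rule ennreal_leI)
    also have "\<dots> = (\<Sum>i\<le>n. \<Prod>j\<in>{..n} - {i}. H (v l j))"
      unfolding H_def by (subst sum_ennreal[symmetric]) (auto simp: prod_ennreal intro!: prod_nonneg sum.cong)
    finally show ?thesis .
  qed
  have "(\<integral>\<^sup>+l. ennreal (cyclic_prod n w l powr (r * real n / real (Suc n))) \<partial>lborel_pow n)
    \<le> (\<integral>\<^sup>+l. (\<Sum>i\<le>n. \<Prod>j\<in>{..n} - {i}. H (v l j)) \<partial>lborel_pow n)"
    by (intro nn_integral_mono pt)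
  also have "\<dots> = (\<Sum>i\<le>n. \<integral>\<^sup>+l. (\<Prod>j\<in>{..n} - {i}. H (v l j)) \<partial>lborel_pow n)"
  proof (rule nn_integral_sum)
    fix i
    have "(\<lambda>l. v l j) \<in> borel_measurable (lborel_pow n)" for j
      unfolding v_def by (cases "j < n") auto
    then show "(\<lambda>l. \<Prod>j\<in>{..n} - {i}. H (v l j)) \<in> borel_measurable (lborel_pow n)"
      by (intro borel_measurable_prod_ennreal measurable_compose[OF _ H])
  qed
  also have "\<dots> = (\<Sum>i\<le>n. (\<integral>\<^sup>+x. H x \<partial>lborel) ^ n)"
    unfolding v_def by (intro sum.cong refl nn_integral_prod_delete[OF H]) simp
  finally show ?thesis by (simp add: H_def)
qed

text \<open>Young's inequality with a parameter \<open>c\<close> that shifts the weight between the two terms.\<close>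

lemma mult_le_powr_add_powr:
  fixes a b c :: real
  assumes "p > 1" "q > 1" "1 / p + 1 / q = 1" "a \<ge> 0" "b \<ge> 0" "c > 0"
  shows "a * b \<le> c powr - p * a powr p + c powr q * b powr q"
proof -
  have "a * b = (a / c) * (c * b)" using assms by simp
  also have "\<dots> \<le> (a / c) powr p / p + (c * b) powr q / q"
    by (rule Youngs_inequality) (use assms in auto)
  also have "\<dots> \<le> (a / c) powr p + (c * b) powr q"
    using assms by (intro add_mono) (auto simp: divide_le_eq mult_left_mono mult_le_cancel_left1)
  also have "\<dots> = c powr - p * a powr p + c powr q * b powr q"
    using assms by (simp add: powr_divide powr_mult powr_minus_divide)
  finally show ?thesis .
qed

text \<open>If \<open>f\<close> is in \<open>L_p\<close>, \<open>W t\<close> is bounded in the dual space \<open>L_q\<close> and \<open>W t\<close> tends to 0 in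
\<open>L_q'\<close> for some \<open>q' \<le> q\<close>, then the integral of \<open>f * W t\<close> tends to 0.\<close>

lemma tendsto_integral_mult_zero:
  fixes f :: "'a \<Rightarrow> real" and W :: "'t \<Rightarrow> 'a \<Rightarrow> real"
  assumes conj: "p > 1" "q > 1" "1 / p + 1 / q = 1" and conj': "p' > 1" "q' > 1" "1 / p' + 1 / q' = 1"
    and pp: "p \<le> p'"
    and f [measurable]: "f \<in> borel_measurable M" and f0: "\<And>x. f x \<ge> 0" and fp: "integrable M (\<lambda>x. f x powr p)"
    and W [measurable]: "\<And>t. W t \<in> borel_measurable M" and W0: "\<And>t x. W t x \<ge> 0"
    and Wq: "eventually (\<lambda>t. integrable M (\<lambda>x. W t x powr q) \<and> (\<integral>x. W t x powr q \<partial>M) \<le> B) F"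
    and Wq': "eventually (\<lambda>t. integrable M (\<lambda>x. W t x powr q')) F"
    and lim: "((\<lambda>t. \<integral>x. W t x powr q' \<partial>M) \<longlongrightarrow> 0) F"
  shows "((\<lambda>t. \<integral>x. f x * W t x \<partial>M) \<longlongrightarrow> 0) F"
proof (rule tendstoI)
  fix e :: real assume e: "e > 0"
  define B' where "B' = \<bar>B\<bar> + 1"
  have B': "B' > 0" "B \<le> B'" by (auto simp: B'_def)
  \<comment> \<open>The order of the choices matters: \<open>\<delta>\<close> makes the \<open>L_q\<close> term of \<open>W\<close> small, then the truncation
    level \<open>R\<close> makes the \<open>L_p\<close> term of the part of \<open>f\<close> above \<open>R\<close> small, then \<open>D\<close> does the same for
    the part of \<open>f\<close> below \<open>R\<close>, which is in \<open>L_p'\<close>; the remaining term tends to 0 with \<open>t\<close>.\<close>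
  define \<delta> where "\<delta> = (e / (4 * B')) powr (1 / q)"
  have \<delta>: "\<delta> > 0" "\<delta> powr q * B' = e / 4"
    using e B' conj by (auto simp: \<delta>_def powr_powr)
  have "(\<lambda>R. \<integral>x. indicator {y. f y > real R} x * f x powr p \<partial>M) \<longlonglongrightarrow> (\<integral>x. 0 \<partial>M)"
  proof (rule integral_dominated_convergence[OF _ _ fp])
    show "AE x in M. (\<lambda>R. indicator {y. f y > real R} x * f x powr p) \<longlonglongrightarrow> 0"
    proof (intro AE_I2 tendsto_eventually)
      fix x
      obtain m :: nat where "f x \<le> real m" using real_arch_simple by blast
      then show "eventually (\<lambda>R. indicator {y. f y > real R} x * f x powr p = 0) sequentially"
        unfolding eventually_sequentially by (intro exI[of _ m]) (auto simp: indicator_def)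
    qed
    show "(\<lambda>x. indicator {y. f y > real R} x * f x powr p) \<in> borel_measurable M" for R
    proof -
      have "(\<lambda>x. if f x > real R then f x powr p else 0) \<in> borel_measurable M" by measurable
      moreover have "(\<lambda>x. if f x > real R then f x powr p else 0) = (\<lambda>x. indicator {y. f y > real R} x * f x powr p)"
        by (auto simp: indicator_def)
      ultimately show ?thesis by simp
    qed
    show "AE x in M. norm (indicator {y. f y > real R} x * f x powr p) \<le> f x powr p" for R
      by (auto simp: indicator_def)
  qed simp
  then have "(\<lambda>R. \<delta> powr - p * (\<integral>x. indicator {y. f y > real R} x * f x powr p \<partial>M)) \<longlonglongrightarrow> 0"
    by (simp add: tendsto_mult_right_zero)
  then have "eventually (\<lambda>R. \<delta> powr - p * (\<integral>x. indicator {y. f y > real R} x * f x powr p \<partial>M) < e / 4) sequentially"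
    using e by (intro order_tendstoD) auto
  then obtain R0 where R0: "\<And>R. R \<ge> R0 \<Longrightarrow> \<delta> powr - p * (\<integral>x. indicator {y. f y > real R} x * f x powr p \<partial>M) < e / 4"
    by (auto simp: eventually_sequentially)
  define R where "R = real (Suc R0)"
  have R: "R > 0" "\<delta> powr - p * (\<integral>x. indicator {y. f y > R} x * f x powr p \<partial>M) < e / 4"
    using R0[of "Suc R0"] by (auto simp: R_def)
  define G where "G = R powr (p' - p) * (\<integral>x. f x powr p \<partial>M) + 1"
  have G: "G > 0" unfolding G_def by (intro add_nonneg_pos mult_nonneg_nonneg integral_nonneg_AE) auto
  define D where "D = (4 * G / e) powr (1 / p')"
  have D: "D > 0" "D powr - p' * G = e / 4"
    using e G conj' by (auto simp: D_def powr_powr powr_minus field_simps)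
  have "((\<lambda>t. D powr q' * (\<integral>x. W t x powr q' \<partial>M)) \<longlongrightarrow> 0) F"
    using lim by (rule tendsto_mult_right_zero)
  then have ev: "eventually (\<lambda>t. D powr q' * (\<integral>x. W t x powr q' \<partial>M) < e / 4) F"
    using e by (intro order_tendstoD) auto
  have big: "integrable M (\<lambda>x. indicator {y. f y > R} x * f x powr p)"
  proof (rule Bochner_Integration.integrable_bound[OF fp])
    have "(\<lambda>x. if f x > R then f x powr p else 0) \<in> borel_measurable M" by measurable
    moreover have "(\<lambda>x. if f x > R then f x powr p else 0) = (\<lambda>x. indicator {y. f y > R} x * f x powr p)"
      by (auto simp: indicator_def)
    ultimately show "(\<lambda>x. indicator {y. f y > R} x * f x powr p) \<in> borel_measurable M" by simp
  qed (auto simp: indicator_def)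
  show "eventually (\<lambda>t. dist (\<integral>x. f x * W t x \<partial>M) 0 < e) F"
    using Wq Wq' ev
  proof eventually_elim
    case (elim t)
    let ?h = "\<lambda>x. \<delta> powr - p * (indicator {y. f y > R} x * f x powr p) + \<delta> powr q * W t x powr q
        + D powr - p' * (R powr (p' - p) * f x powr p) + D powr q' * W t x powr q'"
    have le: "f x * W t x \<le> ?h x" for x
    proof (cases "f x > R")
      case True
      have "f x * W t x \<le> \<delta> powr - p * f x powr p + \<delta> powr q * W t x powr q"
        by (rule mult_le_powr_add_powr) (use conj f0 W0 \<delta> in auto)
      moreover have "0 \<le> D powr - p' * (R powr (p' - p) * f x powr p) + D powr q' * W t x powr q'" by simp
      ultimately have "f x * W t x \<le> (\<delta> powr - p * f x powr p + \<delta> powr q * W t x powr q)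
          + (D powr - p' * (R powr (p' - p) * f x powr p) + D powr q' * W t x powr q')"
        by linarith
      then show ?thesis using True by (simp add: add.assoc)
    next
      case False
      have "f x * W t x \<le> D powr - p' * f x powr p' + D powr q' * W t x powr q'"
        by (rule mult_le_powr_add_powr) (use conj' f0 W0 D in auto)
      moreover have "f x powr p' \<le> R powr (p' - p) * f x powr p"
      proof -
        have "f x powr p' = f x powr (p' - p) * f x powr p" by (simp add: powr_add[symmetric])
        also have "\<dots> \<le> R powr (p' - p) * f x powr p"
          using False f0 pp by (intro mult_right_mono powr_mono2) auto
        finally show ?thesis .
      qed
      then have "D powr - p' * f x powr p' \<le> D powr - p' * (R powr (p' - p) * f x powr p)"
        by (intro mult_left_mono) auto
      moreover have "0 \<le> \<delta> powr - p * (indicator {y. f y > R} x * f x powr p) + \<delta> powr q * W t x powr q" by simp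
      ultimately show ?thesis by linarith
    qed
    have inth: "integrable M ?h" using big fp elim by simp
    have intfW: "integrable M (\<lambda>x. f x * W t x)"
      by (rule Bochner_Integration.integrable_bound[OF inth])
         (use le f0 W0 in \<open>auto intro!: AE_I2 order_trans[OF le abs_ge_self]\<close>)
    have "(\<integral>x. f x * W t x \<partial>M) \<le> integral\<^sup>L M ?h"
      using intfW inth le by (rule integral_mono)
    also have "\<dots> = \<delta> powr - p * (\<integral>x. indicator {y. f y > R} x * f x powr p \<partial>M) + \<delta> powr q * (\<integral>x. W t x powr q \<partial>M)
        + D powr - p' * (R powr (p' - p) * (\<integral>x. f x powr p \<partial>M)) + D powr q' * (\<integral>x. W t x powr q' \<partial>M)"
      using big fp elim by simp
    also have "\<dots> < e / 4 + e / 4 + e / 4 + e / 4"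
    proof (intro add_le_less_mono add_mono)
      show "\<delta> powr - p * (\<integral>x. indicator {y. f y > R} x * f x powr p \<partial>M) \<le> e / 4" using R by simp
      have "\<delta> powr q * (\<integral>x. W t x powr q \<partial>M) \<le> \<delta> powr q * B'"
        using elim B' by (intro mult_left_mono) auto
      then show "\<delta> powr q * (\<integral>x. W t x powr q \<partial>M) \<le> e / 4" using \<delta> by simp
      have "D powr - p' * (R powr (p' - p) * (\<integral>x. f x powr p \<partial>M)) \<le> D powr - p' * G"
        unfolding G_def by (intro mult_left_mono) auto
      then show "D powr - p' * (R powr (p' - p) * (\<integral>x. f x powr p \<partial>M)) \<le> e / 4" using D by simp
      show "D powr q' * (\<integral>x. W t x powr q' \<partial>M) < e / 4" using elim by simp
    qed
    finally have "(\<integral>x. f x * W t x \<partial>M) < e" by simp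
    moreover have "(\<integral>x. f x * W t x \<partial>M) \<ge> 0" using f0 W0 by (intro integral_nonneg_AE) auto
    ultimately show ?case by simp
  qed
qed

lemma integral_cyclic_prod_scale_le:
  fixes w :: "'e::euclidean_space \<Rightarrow> real" and r :: real
  assumes w [measurable]: "w \<in> borel_measurable borel" and w0: "\<And>x. w x \<ge> 0" and n: "n \<ge> 1"
    and r: "integrable lborel (\<lambda>x. w x powr r)" and T: "T > 0"
  defines "W \<equiv> cyclic_prod n (\<lambda>x. T powr (DIM('e) / 2) * w (T *\<^sub>R x))"
  shows "integrable (lborel_pow n) (\<lambda>l. W l powr (r * real n / real (Suc n)))"
    and "(\<integral>l. W l powr (r * real n / real (Suc n)) \<partial>lborel_pow n)
      \<le> real (Suc n) * (T powr (DIM('e) * (r - 2) / 2) * (\<integral>x. w x powr r \<partial>lborel)) ^ n"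
proof -
  let ?v = "\<lambda>x. T powr (DIM('e) / 2) * w (T *\<^sub>R x)"
  let ?I = "\<integral>x. w x powr r \<partial>lborel"
  have I0: "?I \<ge> 0" by (intro integral_nonneg_AE) auto
  have v [measurable]: "?v \<in> borel_measurable borel" by measurable
  have Wm [measurable]: "W \<in> borel_measurable (lborel_pow n)" unfolding W_def by measurable
  have W0: "W l \<ge> 0" for l unfolding W_def cyclic_prod_def using w0 by (intro mult_nonneg_nonneg prod_nonneg) auto
  have "(\<integral>\<^sup>+x. ennreal (?v x powr r) \<partial>lborel)
      = (\<integral>\<^sup>+x. ennreal (T powr (DIM('e) / 2 * r)) * ennreal (w (T *\<^sub>R x) powr r) \<partial>lborel)"
    using w0 by (intro nn_integral_cong) (simp add: powr_mult powr_powr ennreal_mult)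
  also have "\<dots> = ennreal (T powr (DIM('e) / 2 * r)) * (ennreal (T powr - real DIM('e)) * ennreal ?I)"
    using r by (subst nn_integral_cmult) (simp_all add: nn_integral_lborel_scale[where H = "\<lambda>x. ennreal (w x powr r)", OF _ T] nn_integral_eq_integral)
  also have "\<dots> = ennreal (T powr (DIM('e) * (r - 2) / 2) * ?I)"
    using I0 by (simp add: ennreal_mult[symmetric] mult.assoc[symmetric] powr_add[symmetric] field_simps)
  finally have vr: "(\<integral>\<^sup>+x. ennreal (?v x powr r) \<partial>lborel) = ennreal (T powr (DIM('e) * (r - 2) / 2) * ?I)" .
  have "(\<integral>\<^sup>+l. ennreal (W l powr (r * real n / real (Suc n))) \<partial>lborel_pow n)
     \<le> of_nat (Suc n) * (\<integral>\<^sup>+x. ennreal (?v x powr r) \<partial>lborel) ^ n"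
    unfolding W_def by (rule nn_integral_cyclic_prod_powr_le[OF v _ n]) (simp add: w0)
  also have "\<dots> = ennreal (real (Suc n) * (T powr (DIM('e) * (r - 2) / 2) * ?I) ^ n)"
    unfolding vr using I0
    by (subst ennreal_power) (simp_all add: ennreal_mult ennreal_of_nat_eq_real_of_nat del: of_nat_Suc)
  finally have le: "(\<integral>\<^sup>+l. ennreal (W l powr (r * real n / real (Suc n))) \<partial>lborel_pow n)
     \<le> ennreal (real (Suc n) * (T powr (DIM('e) * (r - 2) / 2) * ?I) ^ n)" .
  show int: "integrable (lborel_pow n) (\<lambda>l. W l powr (r * real n / real (Suc n)))"
    using le_less_trans[OF le ennreal_less_top] by (intro integrableI_bounded) auto
  show "(\<integral>l. W l powr (r * real n / real (Suc n)) \<partial>lborel_pow n)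
      \<le> real (Suc n) * (T powr (DIM('e) * (r - 2) / 2) * ?I) ^ n"
    using le I0 by (subst (asm) nn_integral_eq_integral[OF int]) (auto simp: ennreal_le_iff)
qed

text \<open>With \<open>n = k - 1\<close>, the exponent \<open>2 n / (n - 1)\<close> is the exponent \<open>2 (k - 1) / (k - 2)\<close> of the
hypothesis on the spectral density of order \<open>k\<close>.\<close>

lemma tendsto_spectral_integral_zero:
  fixes w :: "'e::euclidean_space \<Rightarrow> real" and f :: "(nat \<Rightarrow> 'e) \<Rightarrow> complex"
  assumes w [measurable]: "w \<in> borel_measurable borel" and w0: "\<And>x. w x \<ge> 0" and n: "n \<ge> 2"
    and r0: "r0 < 2" and wr: "\<And>r. r > r0 \<Longrightarrow> integrable lborel (\<lambda>x. w x powr r)"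
    and f: "in_Lp (2 * real n / (real n - 1)) (lborel_pow n) f"
  shows "((\<lambda>T. T powr (DIM('e) * real (Suc n) / 2)
      * (\<integral>l. cmod (f l) * ((\<Prod>j<n. w (T *\<^sub>R l j)) * w (T *\<^sub>R (\<Sum>j<n. l j))) \<partial>lborel_pow n)) \<longlongrightarrow> 0) at_top"
proof -
  define W where "W T = cyclic_prod n (\<lambda>x. T powr (DIM('e) / 2) * w (T *\<^sub>R x))" for T :: real
  define m where "m = max r0 (real (Suc n) / real n)"
  have "real (Suc n) / real n < 2" using n by (simp add: divide_less_eq)
  then have m: "m < 2" "r0 \<le> m" "real (Suc n) / real n \<le> m" using r0 by (auto simp: m_def)
  \<comment> \<open>Any exponent strictly between \<open>m\<close> and 2; the lower bound \<open>(n + 1) / n\<close> makes \<open>q'\<close> greater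
    than 1.\<close>
  define r where "r = (m + 2) / 2"
  have mr: "m < r" and r2: "r < 2" using m(1) by (simp_all add: r_def)
  have r: "r > r0" "r > real (Suc n) / real n" "r < 2"
    using le_less_trans[OF m(2) mr] le_less_trans[OF m(3) mr] r2 .
  define q where "q = 2 * real n / real (Suc n)"
  define q' where "q' = r * real n / real (Suc n)"
  define p where "p = 2 * real n / (real n - 1)"
  define p' where "p' = q' / (q' - 1)"
  have q1: "q > 1" using n by (simp add: q_def less_divide_eq)
  have q'1: "q' > 1" using r n by (simp add: q'_def field_simps)
  have qq: "q' \<le> q" using r n by (simp add: q_def q'_def divide_right_mono mult_right_mono)
  have "q - 1 = (real n - 1) / real (Suc n)" by (simp add: q_def field_simps)
  then have pq: "p = q / (q - 1)" by (simp add: p_def q_def del: of_nat_Suc)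
  have c1: "p > 1" "1 / p + 1 / q = 1" using q1 unfolding pq by (simp_all add: field_simps)
  have c2: "p' > 1" "1 / p' + 1 / q' = 1" using q'1 unfolding p'_def by (simp_all add: field_simps)
  have pp: "p \<le> p'" using q1 q'1 qq unfolding pq p'_def by (simp add: field_simps)
  have Wm: "W T \<in> borel_measurable (lborel_pow n)" for T
    unfolding W_def by measurable
  have W0: "W T l \<ge> 0" for T l
    unfolding W_def cyclic_prod_def using w0 by (intro mult_nonneg_nonneg prod_nonneg) auto
  have n1: "n \<ge> 1" using n by simp
  note bound = integral_cyclic_prod_scale_le[OF w w0 n1, folded W_def]
  let ?I = "\<lambda>r. \<integral>x. w x powr r \<partial>lborel"
  have lim: "((\<lambda>T. \<integral>l. cmod (f l) * W T l \<partial>lborel_pow n) \<longlongrightarrow> 0) at_top"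
  proof (rule tendsto_integral_mult_zero[OF c1(1) q1 c1(2) c2(1) q'1 c2(2) pp _ _ _ Wm W0])
    show "(\<lambda>l. cmod (f l)) \<in> borel_measurable (lborel_pow n)" "integrable (lborel_pow n) (\<lambda>l. cmod (f l) powr p)"
      using f by (auto simp: in_Lp_def p_def)
    show "eventually (\<lambda>T. integrable (lborel_pow n) (\<lambda>l. W T l powr q)
        \<and> (\<integral>l. W T l powr q \<partial>lborel_pow n) \<le> real (Suc n) * ?I 2 ^ n) at_top"
      using eventually_gt_at_top[of 0]
    proof eventually_elim
      case (elim T)
      show ?case using bound[of 2 T] wr[of 2] r0 elim by (simp add: q_def)
    qed
    show "eventually (\<lambda>T. integrable (lborel_pow n) (\<lambda>l. W T l powr q')) at_top"
      using eventually_gt_at_top[of 0]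
      by eventually_elim (use bound(1) wr r in \<open>simp add: q'_def\<close>)
    show "((\<lambda>T. \<integral>l. W T l powr q' \<partial>lborel_pow n) \<longlongrightarrow> 0) at_top"
    proof (rule tendsto_sandwich[where f = "\<lambda>_. 0"])
      show "eventually (\<lambda>T. (\<integral>l. W T l powr q' \<partial>lborel_pow n)
          \<le> real (Suc n) * (T powr (DIM('e) * (r - 2) / 2) * ?I r) ^ n) at_top"
        using eventually_gt_at_top[of 0]
        by eventually_elim (use bound(2) wr r in \<open>simp add: q'_def\<close>)
      have "((\<lambda>T. T powr (DIM('e) * (r - 2) / 2)) \<longlongrightarrow> 0) at_top"
        using r by (intro tendsto_neg_powr filterlim_ident) (simp add: mult_pos_neg)
      then have "((\<lambda>T. real (Suc n) * (T powr (DIM('e) * (r - 2) / 2) * ?I r) ^ n) \<longlongrightarrow> real (Suc n) * (0 * ?I r) ^ n) at_top"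
        by (intro tendsto_intros)
      then show "((\<lambda>T. real (Suc n) * (T powr (DIM('e) * (r - 2) / 2) * ?I r) ^ n) \<longlongrightarrow> 0) at_top"
        using n by (simp add: power_0_left)
    qed (auto intro!: always_eventually integral_nonneg_AE)
  qed simp
  have eq: "T powr (DIM('e) * real (Suc n) / 2)
      * (\<integral>l. cmod (f l) * ((\<Prod>j<n. w (T *\<^sub>R l j)) * w (T *\<^sub>R (\<Sum>j<n. l j))) \<partial>lborel_pow n)
      = (\<integral>l. cmod (f l) * W T l \<partial>lborel_pow n)" if "T > 0" for T
  proof -
    have p: "T powr (DIM('e) * real (Suc n) / 2) = (T powr (DIM('e) / 2)) ^ n * T powr (DIM('e) / 2)"
      using that by (simp add: powr_realpow[symmetric] powr_powr powr_add[symmetric] field_simps)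
    show ?thesis
      unfolding integral_mult_right_zero[symmetric] W_def cyclic_prod_def p
      by (rule Bochner_Integration.integral_cong) (simp_all add: prod.distrib mult_ac)
  qed
  have "eventually (\<lambda>T. (\<integral>l. cmod (f l) * W T l \<partial>lborel_pow n) = T powr (DIM('e) * real (Suc n) / 2)
      * (\<integral>l. cmod (f l) * ((\<Prod>j<n. w (T *\<^sub>R l j)) * w (T *\<^sub>R (\<Sum>j<n. l j))) \<partial>lborel_pow n)) at_top"
    using eventually_gt_at_top[of 0] by eventually_elim (rule eq[symmetric])
  then show ?thesis by (rule Lim_transform_eventually[OF lim])
qed

section \<open>The variance of the normalised integral\<close>

lemma integral_lborel_affine:
  fixes h :: "'e::euclidean_space \<Rightarrow> 'b::{banach, second_countable_topology}"
  assumes [measurable]: "h \<in> borel_measurable borel" and c: "c \<noteq> 0"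
  shows "(\<integral>y. h y \<partial>lborel) = \<bar>c\<bar> ^ DIM('e) *\<^sub>R (\<integral>u. h (t + c *\<^sub>R u) \<partial>lborel)"
proof -
  have "(\<integral>y. h y \<partial>lborel) = (\<integral>y. h y \<partial>density (distr lborel borel (\<lambda>u. t + c *\<^sub>R u)) (\<lambda>_. \<bar>c\<bar>^DIM('e)))"
    using c by (subst lborel_affine[of c t]) auto
  also have "\<dots> = \<bar>c\<bar> ^ DIM('e) *\<^sub>R (\<integral>u. h (t + c *\<^sub>R u) \<partial>lborel)"
    by (simp add: integral_density integral_distr)
  finally show ?thesis .
qed

lemma integral_lborel_reflect_scale:
  fixes h :: "'e::euclidean_space \<Rightarrow> real"
  assumes h: "h \<in> borel_measurable borel" and T: "T > 0"
  shows "T powr real DIM('e) * (\<integral>y. h y \<partial>lborel) = (\<integral>u. h (x - (1 / T) *\<^sub>R u) \<partial>lborel)"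
  using integral_lborel_affine[OF h, of "- 1 / T" x] T by (simp add: powr_realpow power_divide)

text \<open>The substitution \<open>y = x - u / T\<close> absorbs the factor \<open>T powr d\<close>. As \<open>G\<close> is open, for every
\<open>x \<in> G\<close> and every \<open>u\<close> the point \<open>x - u / T\<close> is eventually in \<open>G\<close>.\<close>

lemma tendsto_double_integral_scaled:
  fixes c :: "'e::euclidean_space \<Rightarrow> real" and G :: "'e set"
  assumes G: "open G" "emeasure lborel G < \<infinity>" and c: "integrable lborel c"
  defines "N \<equiv> density lborel (indicator G)"
  shows "((\<lambda>T. T powr real DIM('e) * (\<integral>x. (\<integral>y. c (T *\<^sub>R x - T *\<^sub>R y) \<partial>N) \<partial>N))
     \<longlongrightarrow> measure lborel G * (\<integral>u. c u \<partial>lborel)) at_top"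
proof -
  have Gm [measurable]: "G \<in> sets borel" using G(1) by simp
  have cm [measurable]: "c \<in> borel_measurable borel" using borel_measurable_integrable[OF c] by simp
  have intN: "(\<integral>x. h x \<partial>N) = (\<integral>x. indicator G x * h x \<partial>lborel)" if "h \<in> borel_measurable borel" for h :: "'e \<Rightarrow> real"
  proof -
    have "N = density lborel (\<lambda>x. ennreal (indicator G x))"
      unfolding N_def by (rule density_cong) (auto simp: ennreal_indicator)
    then show ?thesis using that by (simp add: integral_density)
  qed
  have inner: "((\<lambda>T. \<integral>u. indicator G (x - (1 / T) *\<^sub>R u) * c u \<partial>lborel) \<longlongrightarrow> (\<integral>u. c u \<partial>lborel)) at_top" if x: "x \<in> G" for x
  proof (rule integral_dominated_convergence_at_top[where w = "\<lambda>u. \<bar>c u\<bar>"])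
    show "AE u in lborel. ((\<lambda>T. indicator G (x - (1 / T) *\<^sub>R u) * c u) \<longlongrightarrow> c u) at_top"
    proof (rule AE_I2)
      fix u
      have "((\<lambda>T. x - (1 / T) *\<^sub>R u) \<longlongrightarrow> x - 0 *\<^sub>R u) at_top"
        by (intro tendsto_intros tendsto_divide_0[OF tendsto_const] filterlim_at_top_imp_at_infinity filterlim_ident)
      then have "eventually (\<lambda>T. x - (1 / T) *\<^sub>R u \<in> G) at_top"
        using topological_tendstoD[OF _ G(1)] x by force
      then have "eventually (\<lambda>T. indicator G (x - (1 / T) *\<^sub>R u) * c u = c u) at_top"
        by eventually_elim simp
      then show "((\<lambda>T. indicator G (x - (1 / T) *\<^sub>R u) * c u) \<longlongrightarrow> c u) at_top"
        by (rule tendsto_eventually)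
    qed
  qed (use c in \<open>auto simp: indicator_def intro!: always_eventually AE_I2\<close>)
  have main: "((\<lambda>T. \<integral>x. indicator G x * (\<integral>u. indicator G (x - (1 / T) *\<^sub>R u) * c u \<partial>lborel) \<partial>lborel)
     \<longlongrightarrow> (\<integral>x. indicator G x * (\<integral>u. c u \<partial>lborel) \<partial>lborel)) at_top"
  proof (rule integral_dominated_convergence_at_top[where w = "\<lambda>x. indicator G x * (\<integral>u. \<bar>c u\<bar> \<partial>lborel)"])
    show "integrable lborel (\<lambda>x. indicator G x * (\<integral>u. \<bar>c u\<bar> \<partial>lborel))"
      using G by (intro integrable_mult_left) (auto simp: integrable_indicator_iff)
    show "AE x in lborel. ((\<lambda>T. indicator G x * (\<integral>u. indicator G (x - (1 / T) *\<^sub>R u) * c u \<partial>lborel))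
       \<longlongrightarrow> indicator G x * (\<integral>u. c u \<partial>lborel)) at_top"
      using inner by (intro AE_I2) (auto simp: indicator_def)
    show "eventually (\<lambda>T. AE x in lborel. norm (indicator G x * (\<integral>u. indicator G (x - (1 / T) *\<^sub>R u) * c u \<partial>lborel))
       \<le> indicator G x * (\<integral>u. \<bar>c u\<bar> \<partial>lborel)) at_top"
    proof (intro always_eventually allI AE_I2)
      fix T :: real and x :: 'e
      have int: "integrable lborel (\<lambda>u. indicator G (x - (1 / T) *\<^sub>R u) * c u)"
        by (rule Bochner_Integration.integrable_bound[OF c]) (auto simp: indicator_def)
      have "\<bar>\<integral>u. indicator G (x - (1 / T) *\<^sub>R u) * c u \<partial>lborel\<bar>
          \<le> (\<integral>u. \<bar>indicator G (x - (1 / T) *\<^sub>R u) * c u\<bar> \<partial>lborel)"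
        by (rule integral_abs_bound)
      also have "\<dots> \<le> (\<integral>u. \<bar>c u\<bar> \<partial>lborel)"
        using int c by (intro integral_mono) (auto simp: indicator_def)
      finally have "\<bar>\<integral>u. indicator G (x - (1 / T) *\<^sub>R u) * c u \<partial>lborel\<bar> \<le> (\<integral>u. \<bar>c u\<bar> \<partial>lborel)" .
      then show "norm (indicator G x * (\<integral>u. indicator G (x - (1 / T) *\<^sub>R u) * c u \<partial>lborel))
         \<le> indicator G x * (\<integral>u. \<bar>c u\<bar> \<partial>lborel)"
        by (auto simp: indicator_def)
    qed
  qed measurable
  have eq: "(\<integral>x. indicator G x * (\<integral>u. indicator G (x - (1 / T) *\<^sub>R u) * c u \<partial>lborel) \<partial>lborel)
    = T powr real DIM('e) * (\<integral>x. (\<integral>y. c (T *\<^sub>R x - T *\<^sub>R y) \<partial>N) \<partial>N)" if T: "T > 0" for T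
  proof -
    have inner_eq: "T powr real DIM('e) * (\<integral>y. c (T *\<^sub>R x - T *\<^sub>R y) \<partial>N) = (\<integral>u. indicator G (x - (1 / T) *\<^sub>R u) * c u \<partial>lborel)" for x
      by (subst intN) (use T in \<open>auto simp: integral_lborel_reflect_scale[where x = x, OF _ T] scaleR_diff_right\<close>)
    have "(\<integral>x. (\<integral>y. c (T *\<^sub>R x - T *\<^sub>R y) \<partial>N) \<partial>N) = (\<integral>x. indicator G x * (\<integral>y. c (T *\<^sub>R x - T *\<^sub>R y) \<partial>N) \<partial>lborel)"
    proof (rule intN)
      have "(\<lambda>x. \<integral>y. indicator G y * c (T *\<^sub>R x - T *\<^sub>R y) \<partial>lborel) \<in> borel_measurable borel"
        by measurable
      then show "(\<lambda>x. \<integral>y. c (T *\<^sub>R x - T *\<^sub>R y) \<partial>N) \<in> borel_measurable borel"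
        by (subst intN) simp_all
    qed
    then have "T powr real DIM('e) * (\<integral>x. (\<integral>y. c (T *\<^sub>R x - T *\<^sub>R y) \<partial>N) \<partial>N)
      = (\<integral>x. T powr real DIM('e) * (indicator G x * (\<integral>y. c (T *\<^sub>R x - T *\<^sub>R y) \<partial>N)) \<partial>lborel)"
      by (simp only: integral_mult_right_zero)
    also have "\<dots> = (\<integral>x. indicator G x * (\<integral>u. indicator G (x - (1 / T) *\<^sub>R u) * c u \<partial>lborel) \<partial>lborel)"
      unfolding inner_eq[symmetric] by (simp only: mult.left_commute)
    finally show ?thesis ..
  qed
  have "eventually (\<lambda>T. (\<integral>x. indicator G x * (\<integral>u. indicator G (x - (1 / T) *\<^sub>R u) * c u \<partial>lborel) \<partial>lborel)
    = T powr real DIM('e) * (\<integral>x. (\<integral>y. c (T *\<^sub>R x - T *\<^sub>R y) \<partial>N) \<partial>N)) at_top"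
    using eventually_gt_at_top[of 0] by eventually_elim (rule eq)
  moreover have "(\<integral>x. indicator G x * (\<integral>u. c u \<partial>lborel) \<partial>lborel) = measure lborel G * (\<integral>u. c u \<partial>lborel)"
    by simp
  ultimately show ?thesis using Lim_transform_eventually[OF main] by simp
qed

section \<open>Stationary fields and convex windows\<close>

lemma strictly_stationary_integral:
  fixes X :: "'e::euclidean_space \<Rightarrow> 'w \<Rightarrow> real"
  assumes st: "strictly_stationary M X" and rv: "\<And>t. X t \<in> borel_measurable M"
    and I: "finite I" and g: "g \<in> borel_measurable (\<Pi>\<^sub>M t\<in>I. (borel :: real measure))"
  shows "(\<integral>\<omega>. g (\<lambda>t\<in>I. X (t + h) \<omega>) \<partial>M) = (\<integral>\<omega>. (g (\<lambda>t\<in>I. X t \<omega>) :: real) \<partial>M)"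
proof -
  have eq: "distr M (\<Pi>\<^sub>M t\<in>I. borel) (\<lambda>\<omega>. \<lambda>t\<in>I. X (t + h) \<omega>) = distr M (\<Pi>\<^sub>M t\<in>I. borel) (\<lambda>\<omega>. \<lambda>t\<in>I. X t \<omega>)"
    using st I unfolding strictly_stationary_def by blast
  have m: "(\<lambda>\<omega>. \<lambda>t\<in>I. X (k t) \<omega>) \<in> M \<rightarrow>\<^sub>M (\<Pi>\<^sub>M t\<in>I. borel)" for k
    using rv by (intro measurable_restrict) simp
  show ?thesis
    using arg_cong[OF eq, of "\<lambda>D. integral\<^sup>L D g"]
    by (simp add: integral_distr[OF m g] integral_distr[OF m[of "\<lambda>t. t"] g])
qed

lemma strictly_stationary_moment:
  fixes X :: "'e::euclidean_space \<Rightarrow> 'w \<Rightarrow> real"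
  assumes st: "strictly_stationary M X" and rv: "\<And>t. X t \<in> borel_measurable M"
  shows "(\<integral>\<omega>. \<bar>X t \<omega>\<bar> ^ k \<partial>M) = (\<integral>\<omega>. \<bar>X 0 \<omega>\<bar> ^ k \<partial>M)"
  using strictly_stationary_integral[OF st rv, of "{0}" "\<lambda>x. \<bar>x 0\<bar> ^ k" t] by simp

lemma strictly_stationary_covariance:
  fixes X :: "'e::euclidean_space \<Rightarrow> 'w \<Rightarrow> real"
  assumes st: "strictly_stationary M X" and rv: "\<And>t. X t \<in> borel_measurable M"
  shows "(\<integral>\<omega>. X s \<omega> * X t \<omega> \<partial>M) = (\<integral>\<omega>. X (s - t) \<omega> * X 0 \<omega> \<partial>M)"
  using strictly_stationary_integral[OF st rv, of "{s - t, 0}" "\<lambda>x. x (s - t) * x 0" t] by simp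

text \<open>The frontier of a convex set is a null set. Passing to the interior replaces the completed measure
by Borel Lebesgue measure, for which the product measure theorems are available.\<close>

lemma set_integral_convex_interior:
  fixes h :: "'e::euclidean_space \<Rightarrow> 'b::{banach, second_countable_topology}"
  assumes h: "h \<in> borel_measurable borel" and K: "convex K" "bounded K"
  shows "(LINT t:K|lebesgue. h t) = (\<integral>t. indicator (interior K) t *\<^sub>R h t \<partial>lborel)"
proof -
  have Km: "K \<in> sets lebesgue" using measurable_convex[OF K] by (rule fmeasurableD)
  have hm: "h \<in> borel_measurable lebesgue" using h by (intro measurable_completion) simp
  have Gm: "(\<lambda>t. indicator (interior K) t *\<^sub>R h t) \<in> borel_measurable lborel" using h by measurable
  have "K - interior K \<subseteq> frontier K" using closure_subset by (auto simp: frontier_def)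
  then have "negligible (K - interior K)"
    using negligible_convex_frontier[OF K(1)] negligible_subset by blast
  then have "AE t in lebesgue. t \<notin> K - interior K"
    by (intro AE_not_in) (simp add: negligible_iff_null_sets)
  then have "AE t in lebesgue. indicator K t *\<^sub>R h t = indicator (interior K) t *\<^sub>R h t"
    by eventually_elim (use interior_subset[of K] in \<open>auto simp: indicator_def\<close>)
  then have "(LINT t:K|lebesgue. h t) = (\<integral>t. indicator (interior K) t *\<^sub>R h t \<partial>lebesgue)"
    unfolding set_lebesgue_integral_def
    by (intro integral_cong_AE) (use Km hm measurable_completion[OF Gm] in auto)
  also have "\<dots> = (\<integral>t. indicator (interior K) t *\<^sub>R h t \<partial>lborel)" by (rule integral_completion[OF Gm])
  finally show ?thesis .
qed

lemma set_integral_scaled_convex: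
  fixes h :: "'e::euclidean_space \<Rightarrow> real"
  assumes h: "h \<in> borel_measurable borel" and K: "convex K" "bounded K" and T: "T > 0"
  shows "(LINT t:(\<lambda>x. T *\<^sub>R x) ` K|lebesgue. h t)
     = T powr real DIM('e) * (\<integral>t. h (T *\<^sub>R t) \<partial>density lborel (indicator (interior K)))"
proof -
  have int: "interior ((\<lambda>x. T *\<^sub>R x) ` K) = (\<lambda>x. T *\<^sub>R x) ` interior K"
    using T by (intro interior_injective_linear_image) (auto intro: injI)
  have [measurable]: "(\<lambda>x. T *\<^sub>R x) ` interior K \<in> sets borel"
    using open_scaling[of T "interior K"] T by (intro borel_open) simp
  have hT: "(\<lambda>t. h (T *\<^sub>R t)) \<in> borel_measurable borel" using h by measurable
  have mem: "T *\<^sub>R u \<in> (\<lambda>x. T *\<^sub>R x) ` interior K \<longleftrightarrow> u \<in> interior K" for u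
    using T by (auto simp: image_iff)
  have "(LINT t:(\<lambda>x. T *\<^sub>R x) ` K|lebesgue. h t) = (\<integral>t. indicator ((\<lambda>x. T *\<^sub>R x) ` interior K) t *\<^sub>R h t \<partial>lborel)"
    using set_integral_convex_interior[OF h convex_scaling[OF K(1)] bounded_scaling[OF K(2)], of T] by (simp add: int)
  also have "\<dots> = \<bar>T\<bar> ^ DIM('e) *\<^sub>R (\<integral>u. indicator ((\<lambda>x. T *\<^sub>R x) ` interior K) (0 + T *\<^sub>R u) *\<^sub>R h (0 + T *\<^sub>R u) \<partial>lborel)"
    using h T by (intro integral_lborel_affine) auto
  also have "\<dots> = T powr real DIM('e) * (\<integral>u. indicator (interior K) u * h (T *\<^sub>R u) \<partial>lborel)"
    using T by (simp add: powr_realpow mem indicator_def)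
  also have "(\<integral>u. indicator (interior K) u * h (T *\<^sub>R u) \<partial>lborel) = (\<integral>t. h (T *\<^sub>R t) \<partial>density lborel (indicator (interior K)))"
  proof -
    have "density lborel (indicator (interior K)) = density lborel (\<lambda>x. ennreal (indicator (interior K) x))"
      by (rule density_cong) (auto simp: ennreal_indicator)
    then show ?thesis using hT by (simp add: integral_density)
  qed
  finally show ?thesis .
qed

lemma indicator_fourier_eq_char_fun:
  assumes K: "convex K" "bounded K"
  shows "indicator_fourier K l = char_fun (density lborel (indicator (interior K))) l"
proof -
  have "density lborel (indicator (interior K)) = density lborel (\<lambda>x. ennreal (indicator (interior K) x))"
    by (rule density_cong) (auto simp: ennreal_indicator)
  then show ?thesis
    unfolding indicator_fourier_def char_fun_def
    by (subst set_integral_convex_interior[OF _ K]) (simp_all add: integral_density)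
qed

section \<open>The central limit theorem\<close>

theorem theorem1:
  fixes M :: "'w measure"
    and X :: "'e::euclidean_space \<Rightarrow> 'w \<Rightarrow> real"
    and f :: "nat \<Rightarrow> (nat \<Rightarrow> 'e) \<Rightarrow> complex"
    and K :: "'e set"
    and p_star :: real
  assumes "prob_space M"
    and "measurable_field M X"
    and "strictly_stationary M X"
    and "\<And>t. (\<integral>\<omega>. X t \<omega> \<partial>M) = 0"
    and "\<And>t (k::nat). k \<ge> 2 \<Longrightarrow> integrable M (\<lambda>\<omega>. \<bar>X t \<omega>\<bar> ^ k)"
    and "cumulant_spectral_densities M X f"
    and "bounded K" and "convex K" and "measure lebesgue K > 0" and "0 \<in> K"
    and "1 \<le> p_star" and "p_star < 2"
    and "\<And>p. p > p_star \<Longrightarrow> in_Lp p lborel (indicator_fourier K)"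
    and "bounded (range (\<lambda>x. f 2 (\<lambda>j\<in>{..<1}. x)))"
    and "continuous_on UNIV (\<lambda>x. f 2 (\<lambda>j\<in>{..<1}. x))"
    and "f 2 (\<lambda>j\<in>{..<1}. 0) =
           complex_of_real (1 / (2 * pi) ^ DIM('e) * (\<integral>t. (\<integral>\<omega>. X t \<omega> * X 0 \<omega> \<partial>M) \<partial>lborel))"
    and "f 2 (\<lambda>j\<in>{..<1}. 0) \<noteq> 0"
    and "\<And>k. k \<ge> 3 \<Longrightarrow>
           in_Lp (2 * (real k - 1) / (real k - 2)) (lborel_pow (k - 1)) (f k)"
  shows "\<exists>\<sigma>>0.
           complex_of_real (\<sigma>\<^sup>2) =
             complex_of_real ((2 * pi) ^ DIM('e) * measure lebesgue K) * f 2 (\<lambda>j\<in>{..<1}. 0) \<and>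
           weak_conv_filter
             (\<lambda>T. distr M borel (\<lambda>\<omega>. field_integral X K T \<omega> / T powr (DIM('e) / 2)))
             (density lborel (normal_density 0 \<sigma>))
             at_top"
proof -
  note stat = assms(3) and mean = assms(4) and moments = assms(5) and K = assms(8,7)
  interpret prob_space M by fact
  have Xm [measurable]: "(\<lambda>(t, \<omega>). X t \<omega>) \<in> borel_measurable (borel \<Otimes>\<^sub>M M)"
    using assms(2) by (simp add: measurable_field_def)
  have rv [measurable]: "X t \<in> borel_measurable M" for t
    using measurable_compose[OF measurable_Pair1' Xm, of t] by simp
  have path: "(\<lambda>t. X t \<omega>) \<in> borel_measurable borel" if "\<omega> \<in> space M" for \<omega>
    using measurable_compose[OF measurable_Pair2'[OF that] Xm] by simp
  have abs_moment: "integrable M (\<lambda>\<omega>. \<bar>X t \<omega>\<bar> ^ k)" for t k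
  proof -
    have "k = 0 \<or> k = 1 \<or> k \<ge> 2" by linarith
    moreover have "integrable M (\<lambda>\<omega>. \<bar>X t \<omega>\<bar>)"
    proof (rule Bochner_Integration.integrable_bound[of _ "\<lambda>\<omega>. 1 + \<bar>X t \<omega>\<bar> ^ 2"])
      have "\<bar>x\<bar> \<le> 1 + \<bar>x\<bar> ^ 2" for x :: real
      proof -
        have "0 \<le> (\<bar>x\<bar> - 1) ^ 2" by simp
        then have "2 * \<bar>x\<bar> \<le> \<bar>x\<bar> ^ 2 + 1" unfolding power2_diff by simp
        then show ?thesis by linarith
      qed
      then show "AE \<omega> in M. norm \<bar>X t \<omega>\<bar> \<le> norm (1 + \<bar>X t \<omega>\<bar> ^ 2)" by simp
    qed (use moments[of 2] in auto)
    ultimately show ?thesis using moments by auto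
  qed
  define G where "G = interior K"
  define N where "N = density lborel (indicator G)"
  have G: "open G" by (simp add: G_def)
  have setsN: "sets N = sets borel" by (simp add: N_def)
  have Gfin: "emeasure lborel G < \<infinity>"
    unfolding G_def using K(2) bounded_subset[OF _ interior_subset] by (intro emeasure_bounded_finite) auto
  have Gm [measurable]: "G \<in> sets borel" using G by simp
  have finN: "finite_measure N"
  proof
    have "emeasure N (space N) = emeasure lborel G"
      by (simp add: N_def emeasure_density)
    then show "emeasure N (space N) \<noteq> \<infinity>" using Gfin by simp
  qed
  have measG: "measure lborel G = measure lebesgue K"
  proof -
    have "(LINT t:K|lebesgue. 1) = (\<integral>t. indicator G t *\<^sub>R (1::real) \<partial>lborel)"
      unfolding G_def by (rule set_integral_convex_interior[OF _ K]) simp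
    then show ?thesis by (simp add: set_lebesgue_integral_def)
  qed
  define C where "C k = (\<integral>\<omega>. \<bar>X 0 \<omega>\<bar> ^ k \<partial>M)" for k
  have field: "integrated_field M N (\<lambda>t. X (T *\<^sub>R t)) C" for T
  proof -
    have "case_prod (\<lambda>t. X (T *\<^sub>R t)) \<in> borel_measurable (borel \<Otimes>\<^sub>M M)"
    proof -
      have "(\<lambda>p. (T *\<^sub>R fst p, snd p)) \<in> ((borel :: 'e measure) \<Otimes>\<^sub>M M) \<rightarrow>\<^sub>M ((borel :: 'e measure) \<Otimes>\<^sub>M M)" by measurable
      from measurable_compose[OF this Xm] show ?thesis by (simp add: case_prod_beta)
    qed
    moreover have "sets (N \<Otimes>\<^sub>M M) = sets (borel \<Otimes>\<^sub>M M)"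
      by (intro sets_pair_measure_cong setsN refl)
    ultimately have "case_prod (\<lambda>t. X (T *\<^sub>R t)) \<in> borel_measurable (N \<Otimes>\<^sub>M M)"
      by (simp cong: measurable_cong_sets)
    moreover have "(\<integral>\<omega>. \<bar>X (T *\<^sub>R t) \<omega>\<bar> ^ k \<partial>M) \<le> C k" for t k
      unfolding C_def by (rule eq_refl[OF strictly_stationary_moment[OF stat rv]])
    ultimately show ?thesis
      using prob_space_axioms finN abs_moment rv
      by (simp add: integrated_field_def integrated_field_axioms_def)
  qed
  define S where "S T \<omega> = (\<integral>t. X (T *\<^sub>R t) \<omega> \<partial>N)" for T \<omega>
  have S: "integrated_field.window_integral N (\<lambda>t. X (T *\<^sub>R t)) = S T" for T
    by (rule ext) (simp add: S_def integrated_field.window_integral_def[OF field])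
  define a where "a T = T powr (DIM('e) / 2)" for T :: real
  define Z where "Z T \<omega> = a T * S T \<omega>" for T \<omega>
  have S_rv [measurable]: "S T \<in> borel_measurable M" for T
    using integrated_field.window_integral_measurable[OF field] by (simp add: S)
  have Z_rv: "Z T \<in> borel_measurable M" for T unfolding Z_def by measurable
  have S_power: "integrable M (\<lambda>\<omega>. S T \<omega> ^ n)" for T n
    using integrated_field.window_integral_power(1)[OF field, of "{..<n}"] by (simp add: S)
  have Z_power: "integrable M (\<lambda>\<omega>. Z T \<omega> ^ n)" for T n
    unfolding Z_def power_mult_distrib using S_power by simp
  have EZ: "(\<integral>\<omega>. Z T \<omega> ^ n \<partial>M) = a T ^ n * (\<integral>\<omega>. S T \<omega> ^ n \<partial>M)" for T n
    unfolding Z_def power_mult_distrib by simp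
  define \<mu> where "\<mu> T n = (\<integral>\<omega>. Z T \<omega> ^ n \<partial>M)" for T n
  have \<mu>0: "\<mu> T 0 = 1" for T by (simp add: \<mu>_def prob_space)
  have \<mu>1: "\<mu> T (Suc 0) = 0" for T
  proof -
    have "(\<integral>\<omega>. S T \<omega> ^ card {0::nat} \<partial>M) = (\<integral>t. integrated_field.mixed_moment M (\<lambda>t. X (T *\<^sub>R t)) {0} t \<partial>PiM {0::nat} (\<lambda>_. N))"
      using integrated_field.window_integral_power(2)[OF field, of "{0::nat}"] by (simp only: S finite.intros)
    also have "\<dots> = 0" by (simp add: integrated_field.mixed_moment_def[OF field] mean)
    finally show ?thesis using EZ[of T "Suc 0"] by (simp add: \<mu>_def)
  qed
  define c where "c u = (\<integral>\<omega>. X u \<omega> * X 0 \<omega> \<partial>M)" for u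
  define s where "s = measure lebesgue K * (\<integral>u. c u \<partial>lborel)"
  have "(\<integral>u. c u \<partial>lborel) \<noteq> 0" using assms(16,17) by (auto simp: c_def)
  \<comment> \<open>The integral of a function that is not integrable is 0 by convention, so the hypothesis that the
    spectral density does not vanish at 0 makes the covariance function integrable.\<close>
  then have c_int: "integrable lborel c" using not_integrable_integral_eq by blast
  have s0: "s \<noteq> 0" using \<open>(\<integral>u. c u \<partial>lborel) \<noteq> 0\<close> assms(9) by (simp add: s_def)
  have lim2: "((\<lambda>T. \<mu> T 2) \<longlongrightarrow> s) at_top"
  proof -
    have "\<mu> T 2 = T powr real DIM('e) * (\<integral>x. (\<integral>y. c (T *\<^sub>R x - T *\<^sub>R y) \<partial>N) \<partial>N)" for T
    proof -
      have "(\<integral>\<omega>. S T \<omega> ^ 2 \<partial>M) = (\<integral>x. (\<integral>y. c (T *\<^sub>R x - T *\<^sub>R y) \<partial>N) \<partial>N)"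
        using integrated_field.second_moment[OF field, of T]
        unfolding S c_def strictly_stationary_covariance[OF stat rv, symmetric] .
      moreover have "a T ^ 2 = T powr real DIM('e)"
        by (simp add: a_def power2_eq_square powr_add[symmetric])
      ultimately show ?thesis by (simp add: \<mu>_def EZ)
    qed
    then show ?thesis
      using tendsto_double_integral_scaled[OF G Gfin c_int] by (simp add: N_def s_def measG)
  qed
  have "s \<ge> 0"
    by (rule tendsto_lowerbound[OF lim2]) (auto simp: \<mu>_def intro!: always_eventually)
  with s0 have spos: "s > 0" by simp
  define w where "w l = cmod (char_fun N l)" for l
  have w_eq: "w l = cmod (indicator_fourier K l)" for l
    using indicator_fourier_eq_char_fun[OF K, of l] by (simp add: w_def N_def G_def)
  have wm: "w \<in> borel_measurable borel"
  proof -
    have [measurable]: "indicator_fourier K \<in> borel_measurable borel"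
      using assms(13)[of "p_star + 1"] by (simp add: in_Lp_def)
    have "(\<lambda>l. cmod (indicator_fourier K l)) \<in> borel_measurable borel" by measurable
    then show ?thesis by (simp add: w_eq[abs_def])
  qed
  have wp: "integrable lborel (\<lambda>x. w x powr r)" if "r > p_star" for r
    using assms(13)[OF that] unfolding w_eq in_Lp_def by simp
  have lim3: "((\<lambda>T. partition_cumulant (\<lambda>B. \<mu> T (card B)) {..<k}) \<longlongrightarrow> 0) at_top" if k: "k \<ge> 3" for k :: nat
  proof -
    define n where "n = k - 1"
    have n: "k = Suc n" "n \<ge> 2" using k by (auto simp: n_def)
    have fL: "in_Lp (2 * real n / (real n - 1)) (lborel_pow n) (f k)"
      using assms(18)[OF k] n by simp
    have k2: "k \<ge> 2" using k by simp
    have "integrable (lborel_pow (k - 1)) (f k)"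
      using assms(6) k2 unfolding cumulant_spectral_densities_def by blast
    then have f_int: "integrable (lborel_pow n) (f k)" by (simp only: n_def)
    have spec: "complex_of_real (joint_cumulant M {..<k} (\<lambda>j. X (T *\<^sub>R t j))) =
         (\<integral>l. iexp (\<Sum>j<n. l j \<bullet> (T *\<^sub>R t j - T *\<^sub>R t n)) * f k l \<partial>lborel_pow n)" for T t
    proof -
      have "complex_of_real (joint_cumulant M {..<k} (\<lambda>j. X (u j))) =
           (\<integral>l. iexp (\<Sum>j<k - 1. l j \<bullet> (u j - u (k - 1))) * f k l \<partial>lborel_pow (k - 1))" for u
        using assms(6) k2 unfolding cumulant_spectral_densities_def by blast
      from this[of "\<lambda>j. T *\<^sub>R t j"] show ?thesis by (simp only: n diff_Suc_1)
    qed
    have bound: "\<bar>partition_cumulant (\<lambda>B. \<mu> T (card B)) {..<k}\<bar> \<le> T powr (DIM('e) * real (Suc n) / 2)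
      * (\<integral>l. cmod (f k l) * ((\<Prod>j<n. w (T *\<^sub>R l j)) * w (T *\<^sub>R (\<Sum>j<n. l j))) \<partial>lborel_pow n)" if T: "T > 0" for T
    proof -
      have "partition_cumulant (\<lambda>B. \<mu> T (card B)) {..<k} = a T ^ k * partition_cumulant (\<lambda>B. \<integral>\<omega>. S T \<omega> ^ card B \<partial>M) {..<k}"
        unfolding \<mu>_def EZ by (subst partition_cumulant_scale) auto
      also have "partition_cumulant (\<lambda>B. \<integral>\<omega>. S T \<omega> ^ card B \<partial>M) {..<k}
         = (\<integral>t. joint_cumulant M {..<k} (\<lambda>j. X (T *\<^sub>R t j)) \<partial>PiM {..<k} (\<lambda>_. N))"
        using integrated_field.integral_joint_cumulant[OF field, of "{..<k}"] by (simp add: S)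
      finally have eq: "partition_cumulant (\<lambda>B. \<mu> T (card B)) {..<k}
         = a T ^ k * (\<integral>t. joint_cumulant M {..<k} (\<lambda>j. X (T *\<^sub>R t j)) \<partial>PiM {..<k} (\<lambda>_. N))" .
      have "\<bar>\<integral>t. joint_cumulant M {..<k} (\<lambda>j. X (T *\<^sub>R t j)) \<partial>PiM {..<k} (\<lambda>_. N)\<bar>
        = cmod (\<integral>t. complex_of_real (joint_cumulant M {..<k} (\<lambda>j. X (T *\<^sub>R t j))) \<partial>PiM {..<k} (\<lambda>_. N))"
        by simp
      also have "\<dots> \<le> (\<integral>l. cmod (f k l) * ((\<Prod>j<n. w (T *\<^sub>R l j)) * w (T *\<^sub>R (\<Sum>j<n. l j))) \<partial>lborel_pow n)"
        unfolding spec unfolding n(1) w_def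
        by (rule norm_integral_spectral_le[OF finN setsN f_int[unfolded n(1)]])
      finally have "\<bar>partition_cumulant (\<lambda>B. \<mu> T (card B)) {..<k}\<bar>
        \<le> a T ^ k * (\<integral>l. cmod (f k l) * ((\<Prod>j<n. w (T *\<^sub>R l j)) * w (T *\<^sub>R (\<Sum>j<n. l j))) \<partial>lborel_pow n)"
        unfolding eq abs_mult by (simp add: a_def mult_left_mono)
      moreover have "a T ^ k = T powr (DIM('e) * real (Suc n) / 2)"
        using T unfolding a_def n(1) by (simp add: powr_realpow[symmetric] powr_powr del: of_nat_Suc power_Suc)
      ultimately show ?thesis by simp
    qed
    show ?thesis
    proof (rule Lim_null_comparison)
      show "eventually (\<lambda>T. norm (partition_cumulant (\<lambda>B. \<mu> T (card B)) {..<k}) \<le> T powr (DIM('e) * real (Suc n) / 2)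
        * (\<integral>l. cmod (f k l) * ((\<Prod>j<n. w (T *\<^sub>R l j)) * w (T *\<^sub>R (\<Sum>j<n. l j))) \<partial>lborel_pow n)) at_top"
        using eventually_gt_at_top[of 0] by eventually_elim (simp only: real_norm_def bound)
      show "((\<lambda>T. T powr (DIM('e) * real (Suc n) / 2)
        * (\<integral>l. cmod (f k l) * ((\<Prod>j<n. w (T *\<^sub>R l j)) * w (T *\<^sub>R (\<Sum>j<n. l j))) \<partial>lborel_pow n)) \<longlongrightarrow> 0) at_top"
        by (rule tendsto_spectral_integral_zero[OF wm _ n(2) assms(12) wp fL]) (simp add: w_def)
    qed
  qed
  have low: "partition_cumulant (\<lambda>B. \<mu> T (card B)) {..<Suc 0} = 0" "partition_cumulant (\<lambda>B. \<mu> T (card B)) {..<2::nat} = \<mu> T 2" for T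
    using partition_cumulant_low_orders[of "\<mu> T", OF \<mu>0 \<mu>1] by simp_all
  have lim: "((\<lambda>T. \<mu> T n) \<longlongrightarrow> gauss_moment s n) at_top" for n
    by (rule tendsto_gauss_moment) (use \<mu>0 low lim2 lim3 in simp_all)
  define \<sigma> where "\<sigma> = sqrt s"
  have \<sigma>: "\<sigma> > 0" "\<sigma>\<^sup>2 = s" using spos by (simp_all add: \<sigma>_def)
  have conv: "weak_conv_filter (\<lambda>T. distr M borel (Z T)) (density lborel (normal_density 0 \<sigma>)) at_top"
    by (rule weak_conv_of_moments[OF \<sigma>(1) Z_rv Z_power]) (use lim in \<open>simp add: \<sigma> \<mu>_def\<close>)
  have Z_eq: "distr M borel (\<lambda>\<omega>. field_integral X K T \<omega> / T powr (DIM('e) / 2)) = distr M borel (Z T)"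
    if T: "T > 0" for T
  proof (rule distr_cong[OF refl refl])
    fix \<omega> assume "\<omega> \<in> space M"
    then have "field_integral X K T \<omega> = T powr real DIM('e) * S T \<omega>"
      unfolding field_integral_def S_def N_def G_def by (intro set_integral_scaled_convex K T path)
    moreover have "T powr real DIM('e) = a T * a T" by (simp add: a_def powr_add[symmetric])
    ultimately show "field_integral X K T \<omega> / T powr (DIM('e) / 2) = Z T \<omega>"
      using T by (simp add: Z_def a_def)
  qed
  have "weak_conv_filter
             (\<lambda>T. distr M borel (\<lambda>\<omega>. field_integral X K T \<omega> / T powr (DIM('e) / 2)))
             (density lborel (normal_density 0 \<sigma>)) at_top"
    unfolding weak_conv_filter_def
  proof (intro allI impI)
    fix x assume "isCont (cdf (density lborel (normal_density 0 \<sigma>))) x"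
    then have "((\<lambda>T. cdf (distr M borel (Z T)) x) \<longlongrightarrow> cdf (density lborel (normal_density 0 \<sigma>)) x) at_top"
      using conv unfolding weak_conv_filter_def by blast
    moreover have "eventually (\<lambda>T. cdf (distr M borel (Z T)) x
        = cdf (distr M borel (\<lambda>\<omega>. field_integral X K T \<omega> / T powr (DIM('e) / 2))) x) at_top"
      using eventually_gt_at_top[of 0] by eventually_elim (simp only: Z_eq)
    ultimately show "((\<lambda>T. cdf (distr M borel (\<lambda>\<omega>. field_integral X K T \<omega> / T powr (DIM('e) / 2))) x)
       \<longlongrightarrow> cdf (density lborel (normal_density 0 \<sigma>)) x) at_top"
      by (rule Lim_transform_eventually)
  qed
  moreover have "complex_of_real (\<sigma>\<^sup>2) =
             complex_of_real ((2 * pi) ^ DIM('e) * measure lebesgue K) * f 2 (\<lambda>j\<in>{..<1}. 0)"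
    unfolding assms(16) \<sigma> s_def c_def of_real_mult[symmetric] by simp
  ultimately show ?thesis using \<sigma>(1) by blast
qed

end
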